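(* Let $(X,d)$ be a proper geodesic Gromov hyperbolic metric space, equipped with the simple coarse structure $\mathcal{H}(X)$ whose bounded sets are the subsets of finite diameter and in which two simple ends $\{x_n\}_{n\ge 1}$ and $\{y_n\}_{n\ge 1}$ are equivalent if and only if $\langle x_n,y_n\rangle_p\to\infty$ for some point $p\in X$. Then the geometric Higson corona of $\mathcal{H}(X)$ equals (i.e. is homeomorphic, as a topological space, to) the Gromov boundary $\partial X$ of $X$.
   Context: Bounded structure: a family $\mathcal{B}$ of subsets of $X$ (called bounded sets) containing all singletons, closed under passing to subsets, and such that $A\cup C\in\mathcal{B}$ whenever $A,C\in\mathcal{B}$ and $A\cap C\neq\emptyset$. Simple end: a sequence $\{x_n\}_{n\ge1}$ in $X$ such that $\{n: x_n\in A\}$ is finite for every bounded set $A$. Simple coarse structure: a bounded structure together with an equivalence relation on its set of simple ends. Gromov product: $\langle x,y\rangle_a=\frac12(d(x,a)+d(y,a)-d(x,y))$. $(X,d)$ is Gromov hyperbolic if for some $\delta>0$ one has $\langle x,y\rangle_a\ge\min\{\langle x,z\rangle_a,\langle z,y\rangle_a\}-\delta/4$ for all $x,y,z,a\in X$. A metric space is proper if its closed balls are compact. A function $f:X\to Y$ to a metric space is slowly oscillating (with respect to a simple coarse structure on $X$) if $d_Y(f(x_n),f(y_n))\to0$ for all equivalent simple ends $\{x_n\},\{y_n\}$. If $X$ is locally compact Hausdorff and the bounded sets of the simple coarse structure are exactly the pre-compact subsets of $X$ (subsets with compact closure), the Higson compactification of $X$ is the compactification $\bar X$ such that a function $X\to[0,1]$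 extends to a continuous function $\bar X\to[0,1]$ if and only if it is continuous and slowly oscillating. The geometric Higson corona is $\bar X\setminus X$. Gromov boundary: fix a basepoint $a\in X$. A sequence $\{x_n\}$ converges to infinity if $\liminf_{i,j\to\infty}\langle x_i,x_j\rangle_a=\infty$. Two such sequences are equivalent if $\liminf_{i,j\to\infty}\langle x_i,y_j\rangle_a=\infty$, and $\partial X$ is the set of equivalence classes, with the usual topology: a neighborhood basis at $p\in\partial X$ is given by the sets $U(p,r)$, $r\ge0$, of those $q\in\partial X$ for which there are sequences $\{x_n\}$ representing $p$ and $\{y_n\}$ representing $q$ with $\liminf_{i,j\to\infty}\langle x_i,y_j\rangle_a\ge r$. *)

theory Defs
  imports "HOL-Analysis.Analysis"
begin

section \<open>Simple coarse structures\<close>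

definition bounded_structure :: "'a set set \<Rightarrow> bool" where
  "bounded_structure \<B> \<longleftrightarrow>
     (\<forall>x. {x} \<in> \<B>) \<and>
     (\<forall>A\<in>\<B>. \<forall>C. C \<subseteq> A \<longrightarrow> C \<in> \<B>) \<and>
     (\<forall>A\<in>\<B>. \<forall>C\<in>\<B>. A \<inter> C \<noteq> {} \<longrightarrow> A \<union> C \<in> \<B>)"

definition simple_end :: "'a set set \<Rightarrow> (nat \<Rightarrow> 'a) \<Rightarrow> bool" where
  "simple_end \<B> x \<longleftrightarrow> (\<forall>A\<in>\<B>. finite {n. x n \<in> A})"

record 'a coarse_data =
  bounded_sets :: "'a set set"
  end_equiv :: "((nat \<Rightarrow> 'a) \<times> (nat \<Rightarrow> 'a)) set"

definition simple_coarse_structure :: "'a coarse_data \<Rightarrow> bool" where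
  "simple_coarse_structure \<C> \<longleftrightarrow>
     bounded_structure (bounded_sets \<C>) \<and>
     equiv {x. simple_end (bounded_sets \<C>) x} (end_equiv \<C>)"

definition slowly_oscillating :: "'a coarse_data \<Rightarrow> ('a \<Rightarrow> 'b::metric_space) \<Rightarrow> bool" where
  "slowly_oscillating \<C> f \<longleftrightarrow>
     (\<forall>(x, y) \<in> end_equiv \<C>. (\<lambda>n. dist (f (x n)) (f (y n))) \<longlonglongrightarrow> 0)"


section \<open>Higson compactification and geometric Higson corona\<close>

definition compactification :: "'k topology \<Rightarrow> ('a::topological_space \<Rightarrow> 'k) \<Rightarrow> bool" where
  "compactification K e \<longleftrightarrow>
     compact_space K \<and> Hausdorff_space K \<and>
     embedding_map euclidean K e \<and> K closure_of (range e) = topspace K"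

text \<open>
  The Higson compactification is determined by its extension property only up to
  homeomorphism, so it is a predicate on pairs consisting of a space \<open>K\<close> and an embedding
  \<open>e\<close> of \<open>X\<close> into \<open>K\<close>. The first three conditions are the standing requirements on \<open>X\<close>
  (Hausdorffness is the sort constraint) and on the structure for the notion to be defined.
\<close>

definition higson_compactification ::
  "'a::t2_space coarse_data \<Rightarrow> 'k topology \<Rightarrow> ('a \<Rightarrow> 'k) \<Rightarrow> bool" where
  "higson_compactification \<C> K e \<longleftrightarrow>
     simple_coarse_structure \<C> \<and>
     locally_compact_space (euclidean :: 'a topology) \<and>
     bounded_sets \<C> = {A. compact (closure A)} \<and>
     compactification K e \<and>
     (\<forall>f :: 'a \<Rightarrow> real. range f \<subseteq> {0..1} \<longrightarrow>
        ((\<exists>g. continuous_map K (top_of_set {0..1}) g \<and> (\<forall>x. g (e x) = f x)) \<longleftrightarrow>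
         continuous_on UNIV f \<and> slowly_oscillating \<C> f))"

definition corona :: "'k topology \<Rightarrow> ('a \<Rightarrow> 'k) \<Rightarrow> 'k topology" where
  "corona K e = subtopology K (topspace K - range e)"


section \<open>Proper geodesic Gromov hyperbolic spaces\<close>

definition gromov_product :: "'a::metric_space \<Rightarrow> 'a \<Rightarrow> 'a \<Rightarrow> real" where
  "gromov_product a x y = (dist x a + dist y a - dist x y) / 2"

definition gromov_hyperbolic :: "'a::metric_space itself \<Rightarrow> bool" where
  "gromov_hyperbolic _ \<longleftrightarrow>
     (\<exists>\<delta>>0. \<forall>x y z a :: 'a.
        gromov_product a x y \<ge> min (gromov_product a x z) (gromov_product a z y) - \<delta> / 4)"

definition proper_metric :: "'a::metric_space itself \<Rightarrow> bool" where
  "proper_metric _ \<longleftrightarrow> (\<forall>(x::'a) r. compact (cball x r))"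

definition geodesic_metric :: "'a::metric_space itself \<Rightarrow> bool" where
  "geodesic_metric _ \<longleftrightarrow>
     (\<forall>x y :: 'a. \<exists>c :: real \<Rightarrow> 'a. c 0 = x \<and> c (dist x y) = y \<and>
        (\<forall>s\<in>{0..dist x y}. \<forall>t\<in>{0..dist x y}. dist (c s) (c t) = \<bar>s - t\<bar>))"

definition gromov_coarse :: "'a::metric_space coarse_data" where
  "gromov_coarse =
     \<lparr> bounded_sets = {A. bounded A},
       end_equiv = {(x, y). simple_end {A. bounded A} x \<and> simple_end {A. bounded A} y \<and>
         (\<exists>p. filterlim (\<lambda>n. gromov_product p (x n) (y n)) at_top sequentially)} \<rparr>"


section \<open>The Gromov boundary\<close>

definition gromov_liminf :: "'a::metric_space \<Rightarrow> (nat \<Rightarrow> 'a) \<Rightarrow> (nat \<Rightarrow> 'a) \<Rightarrow> ereal" where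
  "gromov_liminf a x y =
     Liminf (sequentially \<times>\<^sub>F sequentially) (\<lambda>(i, j). ereal (gromov_product a (x i) (y j)))"

definition converging_to_infinity :: "'a::metric_space \<Rightarrow> (nat \<Rightarrow> 'a) set" where
  "converging_to_infinity a = {x. gromov_liminf a x x = \<infinity>}"

definition boundary_equiv :: "'a::metric_space \<Rightarrow> ((nat \<Rightarrow> 'a) \<times> (nat \<Rightarrow> 'a)) set" where
  "boundary_equiv a =
     {(x, y). x \<in> converging_to_infinity a \<and> y \<in> converging_to_infinity a \<and>
              gromov_liminf a x y = \<infinity>}"

definition gromov_boundary_points :: "'a::metric_space \<Rightarrow> (nat \<Rightarrow> 'a) set set" where
  "gromov_boundary_points a = converging_to_infinity a // boundary_equiv a"

definition boundary_nhd ::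
  "'a::metric_space \<Rightarrow> (nat \<Rightarrow> 'a) set \<Rightarrow> real \<Rightarrow> (nat \<Rightarrow> 'a) set set" where
  "boundary_nhd a p r =
     {q \<in> gromov_boundary_points a. \<exists>x\<in>p. \<exists>y\<in>q. gromov_liminf a x y \<ge> ereal r}"

text \<open>
  The sets \<open>boundary_nhd a p r\<close> need not be open. A set is open iff it contains
  one of them around each of its points; this is the only topology that can have them as
  neighbourhood bases.
\<close>

definition gromov_boundary :: "'a::metric_space \<Rightarrow> (nat \<Rightarrow> 'a) set topology" where
  "gromov_boundary a =
     topology (\<lambda>U. U \<subseteq> gromov_boundary_points a \<and>
                   (\<forall>p\<in>U. \<exists>r\<ge>0. boundary_nhd a p r \<subseteq> U))"

lemma boundary_nhd_antimono:
  assumes "r \<le> s"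
  shows "boundary_nhd a p s \<subseteq> boundary_nhd a p r"
proof -
  have "ereal r \<le> v" if "ereal s \<le> v" for v
    using assms that by (meson ereal_less_eq(3) order_trans)
  then show ?thesis unfolding boundary_nhd_def by blast
qed

lemma openin_gromov_boundary:
  "openin (gromov_boundary a) U \<longleftrightarrow>
     U \<subseteq> gromov_boundary_points a \<and> (\<forall>p\<in>U. \<exists>r\<ge>0. boundary_nhd a p r \<subseteq> U)"
proof -
  let ?P = "\<lambda>U. U \<subseteq> gromov_boundary_points a \<and> (\<forall>p\<in>U. \<exists>r\<ge>0. boundary_nhd a p r \<subseteq> U)"
  have "?P (S \<inter> T)" if S: "?P S" and T: "?P T" for S T
  proof (intro conjI ballI)
    show "S \<inter> T \<subseteq> gromov_boundary_points a" using S by blast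
    fix p assume p: "p \<in> S \<inter> T"
    obtain r where r: "r \<ge> 0" "boundary_nhd a p r \<subseteq> S" using S p by blast
    obtain s where s: "s \<ge> 0" "boundary_nhd a p s \<subseteq> T" using T p by blast
    have "boundary_nhd a p (max r s) \<subseteq> S \<inter> T"
      using r s boundary_nhd_antimono[of r "max r s" a p] boundary_nhd_antimono[of s "max r s" a p]
      by auto
    then show "\<exists>r\<ge>0. boundary_nhd a p r \<subseteq> S \<inter> T" using r(1) by (intro exI[of _ "max r s"]) auto
  qed
  moreover have "?P (\<Union>\<K>)" if "\<forall>S\<in>\<K>. ?P S" for \<K>
    using that by (meson Sup_least UnionE Union_upper order_trans)
  ultimately have "istopology ?P"
    unfolding istopology_def by blast
  then show ?thesis
    unfolding gromov_boundary_def by (simp add: topology_inverse')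
qed

lemma topspace_gromov_boundary [simp]: "topspace (gromov_boundary a) = gromov_boundary_points a"
proof -
  have "openin (gromov_boundary a) (gromov_boundary_points a)"
    unfolding openin_gromov_boundary boundary_nhd_def by auto
  then show ?thesis
    using openin_gromov_boundary openin_topspace by (metis openin_subset subset_antisym)
qed


section \<open>Well-definedness of the coarse structure\<close>

lemma gromov_product_change_base: "gromov_product p x y \<le> gromov_product q x y + dist p q"
  unfolding gromov_product_def
  using dist_triangle[of x p q] dist_triangle[of y p q] by (simp add: dist_commute field_simps)

lemma simple_coarse_structure_gromov_coarse:
  assumes "gromov_hyperbolic TYPE('a::metric_space)"
  shows "simple_coarse_structure (gromov_coarse :: 'a coarse_data)"
proof -
  let ?B = "{A :: 'a set. bounded A}"
  let ?E = "end_equiv (gromov_coarse :: 'a coarse_data)"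
  obtain \<delta> where \<delta>: "\<And>x y z a :: 'a.
      gromov_product a x y \<ge> min (gromov_product a x z) (gromov_product a z y) - \<delta> / 4"
    using assms unfolding gromov_hyperbolic_def by blast
  have E: "(x, y) \<in> ?E \<longleftrightarrow> simple_end ?B x \<and> simple_end ?B y \<and>
      (\<exists>p. filterlim (\<lambda>n. gromov_product p (x n) (y n)) at_top sequentially)" for x y
    by (simp add: gromov_coarse_def)
  have base: "filterlim (\<lambda>n. gromov_product q (x n) (y n)) at_top sequentially"
    if "filterlim (\<lambda>n. gromov_product p (x n) (y n)) at_top sequentially" for p q :: 'a and x y
    unfolding filterlim_at_top
  proof
    fix Z :: real
    show "\<forall>\<^sub>F n in sequentially. Z \<le> gromov_product q (x n) (y n)"
      using that[unfolded filterlim_at_top, rule_format, of "Z + dist p q"]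
      by (rule eventually_mono) (smt (verit) gromov_product_change_base)
  qed
  have refl: "(x, x) \<in> ?E" if x: "simple_end ?B x" for x :: "nat \<Rightarrow> 'a"
  proof -
    have "filterlim (\<lambda>n. gromov_product undefined (x n) (x n)) at_top sequentially"
      unfolding filterlim_at_top
    proof
      fix Z :: real
      have "finite {n. x n \<in> cball undefined Z}"
        using x bounded_cball unfolding simple_end_def by blast
      then show "\<forall>\<^sub>F n in sequentially. Z \<le> gromov_product undefined (x n) (x n)"
        unfolding cofinite_eq_sequentially[symmetric] eventually_cofinite
        by (rule rev_finite_subset) (auto simp: gromov_product_def dist_commute)
    qed
    then show ?thesis using x unfolding E by blast
  qed
  have trans: "(x, z) \<in> ?E" if xy: "(x, y) \<in> ?E" and yz: "(y, z) \<in> ?E" for x y z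
  proof -
    obtain p where p: "filterlim (\<lambda>n. gromov_product p (x n) (y n)) at_top sequentially"
      using xy unfolding E by blast
    have q: "filterlim (\<lambda>n. gromov_product p (y n) (z n)) at_top sequentially"
      using yz base unfolding E by blast
    have "filterlim (\<lambda>n. gromov_product p (x n) (z n)) at_top sequentially"
      unfolding filterlim_at_top
    proof
      fix Z :: real
      show "\<forall>\<^sub>F n in sequentially. Z \<le> gromov_product p (x n) (z n)"
        using p[unfolded filterlim_at_top, rule_format, of "Z + \<delta> / 4"]
              q[unfolded filterlim_at_top, rule_format, of "Z + \<delta> / 4"]
      proof eventually_elim
        case (elim n)
        then show ?case using \<delta>[of p "x n" "y n" "z n"] by linarith
      qed
    qed
    then show ?thesis using xy yz unfolding E by blast
  qed
  have sym: "(y, x) \<in> ?E" if "(x, y) \<in> ?E" for x y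
  proof -
    have "gromov_product p u v = gromov_product p v u" for p u v :: 'a
      by (simp add: gromov_product_def dist_commute)
    then show ?thesis using that unfolding E by simp
  qed
  have "equiv {x. simple_end ?B x} ?E"
  proof (rule equivI)
    show "?E \<subseteq> {x. simple_end ?B x} \<times> {x. simple_end ?B x}" using E by auto
    show "refl_on {x. simple_end ?B x} ?E" using refl by (auto simp: refl_on_def)
    show "sym ?E" using sym by (rule symI)
    show "trans ?E" using trans by (rule transI)
  qed
  moreover have "bounded_structure ?B"
    unfolding bounded_structure_def by (auto intro: bounded_subset)
  moreover have "bounded_sets (gromov_coarse :: 'a coarse_data) = ?B"
    by (simp add: gromov_coarse_def)
  ultimately show ?thesis
    unfolding simple_coarse_structure_def by simp
qed

lemma bounded_sets_gromov_coarse: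
  assumes "proper_metric TYPE('a::metric_space)"
  shows "bounded_sets (gromov_coarse :: 'a coarse_data) = {A. compact (closure A)}"
proof -
  have "bounded A \<longleftrightarrow> compact (closure A)" for A :: "'a set"
  proof
    assume "bounded A"
    then obtain x r where "\<forall>y\<in>A. dist x y \<le> r" unfolding bounded_def by blast
    then have A: "A \<subseteq> cball x r" by auto
    have "closure A \<subseteq> cball x r" using A by (rule closure_minimal) simp
    then have "cball x r \<inter> closure A = closure A" by (simp add: Int_absorb1)
    moreover have "compact (cball x r)" using assms by (simp add: proper_metric_def)
    ultimately show "compact (closure A)"
      using compact_Int_closed[OF _ closed_closure, of "cball x r" A] by simp
  next
    assume "compact (closure A)"
    then show "bounded A"
      by (rule bounded_subset[OF compact_imp_bounded closure_subset])
  qed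
  then show ?thesis by (simp add: gromov_coarse_def)
qed

end

theory Submission
  imports Defs
begin

text \<open>
  Existence: \<open>X\<close> embeds into the cube indexed by the continuous slowly oscillating functions into
  \<open>[0,1]\<close>; on the closure of the image no other functions extend, because by compactness a
  continuous function there depends, up to any \<open>\<epsilon>\<close>, on finitely many coordinates.

  The homeomorphism sends the class of a sequence converging to infinity to its limit in \<open>K\<close>. A
  continuous \<open>g\<close> on \<open>K\<close> satisfies: for every \<open>\<epsilon> > 0\<close> there is \<open>C\<close> such that Gromov product at least
  \<open>C\<close> forces the values of \<open>g\<close> to be \<open>\<epsilon>\<close>-close. With Urysohn functions \<open>g\<close> this gives existence and
  uniqueness of the limits and continuity of the map. Injectivity and openness need slowly
  oscillating functions on \<open>X\<close> that separate boundary points; these are chain distances to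
  the tail of a sequence for the quasi-metric
  \<open>min (sqrt (dist x y)) (exp (- scale * gromov_product a x y))\<close>, bounded below by Frink's chain lemma.
  For surjectivity, geodesics and properness give finite covers of the complement of a ball by sets
  with large mutual Gromov products; following a corona point through these covers yields a sequence
  converging to it.
\<close>

section \<open>Chains for a quasi-ultrametric\<close>

text \<open>Frink's argument: cut the chain at the last vertex, other than the final one, up to
  which at most half of the total has accumulated. Both outer pieces carry at most half, so by
  induction their endpoints are within the total; so is the single link between them, and the
  four-point inequality adds the factor 2.\<close>

lemma chain_sum_lower_bound:
  fixes s :: "'a \<Rightarrow> 'a \<Rightarrow> real"
  assumes nonneg: "\<And>x y. 0 \<le> s x y" and refl: "\<And>x. s x x = 0"
    and quasi: "\<And>x y z w. s x w \<le> 2 * max (s x y) (max (s y z) (s z w))"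
  assumes "m \<le> n"
  shows "s (x m) (x n) \<le> 2 * (\<Sum>i=m..<n. s (x i) (x (Suc i)))"
  using \<open>m \<le> n\<close>
proof (induction "n - m" arbitrary: m n rule: less_induct)
  case less
  define S where "S = (\<lambda>i j. \<Sum>i=i..<j. s (x i) (x (Suc i)))"
  have S_nonneg: "0 \<le> S i j" for i j
    unfolding S_def by (intro sum_nonneg nonneg)
  have S_add: "S i j + S j l = S i l" if "i \<le> j" "j \<le> l" for i j l
    unfolding S_def using that by (rule sum.atLeastLessThan_concat)
  have IH: "s (x i) (x j) \<le> 2 * S i j" if "i \<le> j" "j - i < n - m" for i j
    unfolding S_def using less(1) that by blast
  show ?case
  proof (cases "m = n")
    case True
    then show ?thesis by (simp add: refl)
  next
    case False
    with less have mn: "m < n" by simp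
    \<comment> \<open>\<open>l < n\<close> makes the initial piece strictly shorter than the chain,
      as the induction hypothesis requires.\<close>
    define A where "A = {l. m \<le> l \<and> l < n \<and> S m l \<le> S m n / 2}"
    have "finite A" unfolding A_def by simp
    have "m \<in> A" unfolding A_def using mn S_nonneg[of m n] by (simp add: S_def)
    define l where "l = Max A"
    have l: "l \<in> A" unfolding l_def using \<open>finite A\<close> \<open>m \<in> A\<close> by (metis Max_in empty_iff)
    have first: "s (x m) (x l) \<le> S m n"
      using IH[of m l] l diff_less_mono[of l n m] unfolding A_def by simp
    have "S l (Suc l) \<le> S m n"
      using S_add[of m l n] S_add[of l "Suc l" n] S_nonneg[of m l] S_nonneg[of "Suc l" n] l
      unfolding A_def by simp
    then have mid: "s (x l) (x (Suc l)) \<le> S m n" by (simp add: S_def)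
    have last: "s (x (Suc l)) (x n) \<le> S m n"
    proof (cases "Suc l = n")
      case True
      then show ?thesis using refl S_nonneg by simp
    next
      case False
      \<comment> \<open>By maximality more than half of the total lies before \<open>Suc l\<close>,
        so less than half remains.\<close>
      have "Suc l \<notin> A" using Max_ge[OF \<open>finite A\<close>, of "Suc l"] unfolding l_def by auto
      then have "S m (Suc l) > S m n / 2" using l False unfolding A_def by simp
      then have "S (Suc l) n \<le> S m n / 2"
        using S_add[of m "Suc l" n] l unfolding A_def by simp
      then show ?thesis using IH[of "Suc l" n] l diff_less_mono2[of m "Suc l" n] mn unfolding A_def by simp
    qed
    have "s (x m) (x n) \<le> 2 * S m n"
      using quasi[of "x m" "x n" "x l" "x (Suc l)"] first mid last by linarith
    then show ?thesis by (simp add: S_def)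
  qed
qed

text \<open>Since \<open>s\<close> need not satisfy the triangle inequality, \<open>z \<mapsto> inf {s z w | w \<in> S}\<close> need not be
  1-Lipschitz for \<open>s\<close>; the infimum over chains is, at the cost of the factor 2.\<close>

lemma chain_distance_exists:
  fixes s :: "'a \<Rightarrow> 'a \<Rightarrow> real"
  assumes nonneg: "\<And>x y. 0 \<le> s x y" and refl: "\<And>x. s x x = 0" and sym: "\<And>x y. s x y = s y x"
    and quasi: "\<And>x y z w. s x w \<le> 2 * max (s x y) (max (s y z) (s z w))"
    and le1: "\<And>x y. s x y \<le> 1"
    and "S \<noteq> {}"
  obtains f where "\<And>z w. \<bar>f z - f w\<bar> \<le> s z w" "\<And>z. z \<in> S \<Longrightarrow> f z = 0" "range f \<subseteq> {0..1}"
    "\<And>z c. (\<And>w. w \<in> S \<Longrightarrow> c \<le> s z w) \<Longrightarrow> c / 2 \<le> f z"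
proof
  define C where "C = (\<lambda>z. {(\<Sum>i<n. s (x i) (x (Suc i))) | x n. x 0 = z \<and> x n \<in> S})"
  define f where "f = (\<lambda>z. Inf (C z))"
  have C_single: "s z w \<in> C z" if "w \<in> S" for z w
    unfolding C_def using that
    by (intro CollectI exI[of _ "case_nat z (\<lambda>_. w)"] exI[of _ "Suc 0"]) simp
  have C_nonneg: "0 \<le> t" if "t \<in> C z" for t z
    using that unfolding C_def by (auto intro!: sum_nonneg nonneg)
  then have bdd: "bdd_below (C z)" for z by (meson bdd_belowI)
  have ne: "C z \<noteq> {}" for z using \<open>S \<noteq> {}\<close> C_single by blast
  have C_cons: "s z w + t \<in> C z" if t: "t \<in> C w" for z w t
  proof -
    obtain x n where x: "x 0 = w" "x n \<in> S" "t = (\<Sum>i<n. s (x i) (x (Suc i)))"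
      using t unfolding C_def by blast
    show ?thesis unfolding C_def using x
      by (intro CollectI exI[of _ "case_nat z x"] exI[of _ "Suc n"])
         (simp add: sum.lessThan_Suc_shift del: sum.lessThan_Suc)
  qed
  \<comment> \<open>Prepending a link turns chains from \<open>w\<close> into chains from
    \<open>z\<close>; infima give one half of the Lipschitz bound, symmetry the other.\<close>
  have half: "f z - f w \<le> s z w" for z w
  proof -
    have "f z - s z w \<le> t" if "t \<in> C w" for t
      using cInf_lower[OF C_cons[OF that] bdd, of z] unfolding f_def by simp
    then have "f z - s z w \<le> f w" unfolding f_def by (intro cInf_greatest ne) auto
    then show ?thesis by simp
  qed
  show "\<bar>f z - f w\<bar> \<le> s z w" for z w using half[of z w] half[of w z] sym[of z w] by simp
  have f_nonneg: "0 \<le> f z" for z unfolding f_def by (intro cInf_greatest ne C_nonneg)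
  have f_le: "f z \<le> s z w" if "w \<in> S" for z w
    unfolding f_def by (intro cInf_lower C_single bdd that)
  show "f z = 0" if "z \<in> S" for z using f_le[OF that, of z] f_nonneg[of z] refl by simp
  show "range f \<subseteq> {0..1}" using f_nonneg f_le le1 \<open>S \<noteq> {}\<close> by (fastforce intro: order_trans)
  show "c / 2 \<le> f z" if c: "\<And>w. w \<in> S \<Longrightarrow> c \<le> s z w" for z c
    unfolding f_def
  proof (intro cInf_greatest ne)
    fix t assume "t \<in> C z"
    then obtain x n where x: "x 0 = z" "x n \<in> S" "t = (\<Sum>i<n. s (x i) (x (Suc i)))"
      unfolding C_def by blast
    have "s (x 0) (x n) \<le> 2 * t"
      using chain_sum_lower_bound[of s 0 n x, OF nonneg refl quasi] unfolding x(3) lessThan_atLeast0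
      by blast
    then show "c / 2 \<le> t" using c[OF x(2)] x(1) by simp
  qed
qed

section \<open>Gromov products\<close>

lemma gromov_product_commute: "gromov_product b x y = gromov_product b y x"
  by (simp add: gromov_product_def dist_commute)

lemma gromov_product_nonneg: "0 \<le> gromov_product b x y"
  unfolding gromov_product_def using dist_triangle[of x y b] by (simp add: dist_commute)

lemma gromov_product_le_dist: "gromov_product b x y \<le> dist x b"
  unfolding gromov_product_def using dist_triangle[of y b x] by (simp add: dist_commute)

lemma gromov_product_ge_dist_diff: "dist x b - dist x y \<le> gromov_product b x y"
  unfolding gromov_product_def using dist_triangle[of x b y] by (simp add: field_simps)

lemma gromov_product_diff_le: "gromov_product b z y - dist x z \<le> gromov_product b x y"
  unfolding gromov_product_def using dist_triangle[of z b x] dist_triangle[of x y z]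
  by (simp add: dist_commute field_simps)

lemma gromov_liminf_ge_imp:
  assumes "ereal r \<le> gromov_liminf b x y" "t < r"
  shows "\<exists>N. \<forall>i\<ge>N. \<forall>j\<ge>N. t < gromov_product b (x i) (y j)"
proof -
  have "eventually (\<lambda>(i, j). ereal t < ereal (gromov_product b (x i) (y j)))
      (sequentially \<times>\<^sub>F sequentially)"
    using assms unfolding gromov_liminf_def le_Liminf_iff
    by (auto simp: case_prod_unfold dest!: spec[of _ "ereal t"])
  then show ?thesis unfolding eventually_prod_sequentially by auto
qed

lemma gromov_liminf_geI:
  assumes "\<And>i j. N \<le> i \<Longrightarrow> N \<le> j \<Longrightarrow> r \<le> gromov_product b (x i) (y j)"
  shows "ereal r \<le> gromov_liminf b x y"
  unfolding gromov_liminf_def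
  by (rule Liminf_bounded) (use assms in \<open>auto simp: eventually_prod_sequentially\<close>)

lemma gromov_liminf_eq_infinity_iff:
  "gromov_liminf b x y = \<infinity> \<longleftrightarrow> (\<forall>C. \<exists>N. \<forall>i\<ge>N. \<forall>j\<ge>N. C \<le> gromov_product b (x i) (y j))"
proof (intro iffI allI)
  fix C
  assume "gromov_liminf b x y = \<infinity>"
  then have "ereal (C + 1) \<le> gromov_liminf b x y" by simp
  from gromov_liminf_ge_imp[OF this, of C]
  show "\<exists>N. \<forall>i\<ge>N. \<forall>j\<ge>N. C \<le> gromov_product b (x i) (y j)" by fastforce
next
  assume "\<forall>C. \<exists>N. \<forall>i\<ge>N. \<forall>j\<ge>N. C \<le> gromov_product b (x i) (y j)"
  then have "ereal C \<le> gromov_liminf b x y" for C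
    using gromov_liminf_geI by metis
  then show "gromov_liminf b x y = \<infinity>"
    by (metis ereal_top top_ereal_def)
qed

lemma gromov_liminf_commute: "gromov_liminf b x y = \<infinity> \<longleftrightarrow> gromov_liminf b y x = \<infinity>"
  unfolding gromov_liminf_eq_infinity_iff by (metis gromov_product_commute)

lemma converging_to_infinity_iff:
  "x \<in> converging_to_infinity b \<longleftrightarrow> (\<forall>C. \<exists>N. \<forall>i\<ge>N. \<forall>j\<ge>N. C \<le> gromov_product b (x i) (x j))"
  by (simp add: converging_to_infinity_def gromov_liminf_eq_infinity_iff)

lemma simple_end_bounded_iff:
  fixes b :: "'a::metric_space"
  shows "simple_end {A. bounded A} x \<longleftrightarrow> filterlim (\<lambda>n. dist (x n) b) at_top sequentially"
proof
  assume x: "simple_end {A. bounded A} x"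
  show "filterlim (\<lambda>n. dist (x n) b) at_top sequentially"
    unfolding filterlim_at_top
  proof
    fix Z
    have "finite {n. x n \<in> cball b Z}" using x bounded_cball unfolding simple_end_def by blast
    then show "\<forall>\<^sub>F n in sequentially. Z \<le> dist (x n) b"
      unfolding cofinite_eq_sequentially[symmetric] eventually_cofinite
      by (rule rev_finite_subset) (auto simp: dist_commute)
  qed
next
  assume lim: "filterlim (\<lambda>n. dist (x n) b) at_top sequentially"
  show "simple_end {A. bounded A} x"
    unfolding simple_end_def
  proof
    fix A :: "'a set" assume "A \<in> {A. bounded A}"
    then obtain r where r: "\<forall>y\<in>A. dist b y \<le> r" 
      using bounded_any_center[of A b] by blast
    have "\<forall>\<^sub>F n in sequentially. r < dist (x n) b"
      using lim unfolding filterlim_at_top_dense by blast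
    then have "finite {n. \<not> r < dist (x n) b}"
      unfolding cofinite_eq_sequentially[symmetric] eventually_cofinite .
    then show "finite {n. x n \<in> A}"
      by (rule rev_finite_subset) (use r in \<open>auto simp: dist_commute not_less\<close>)
  qed
qed

text \<open>Moving the base point changes the product by at most the distance moved, so any
  \<open>b\<close> will do. The product is bounded by both distances to \<open>b\<close>, so its
  divergence alone makes both sequences simple ends.\<close>

lemma end_equiv_gromov_coarse_iff:
  "(x, y) \<in> end_equiv gromov_coarse \<longleftrightarrow>
     filterlim (\<lambda>n. gromov_product b (x n) (y n)) at_top sequentially"
proof
  assume "(x, y) \<in> end_equiv gromov_coarse"
  then obtain p where p: "filterlim (\<lambda>n. gromov_product p (x n) (y n)) at_top sequentially"
    unfolding gromov_coarse_def by auto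
  have "filterlim (\<lambda>n. - dist p b + gromov_product p (x n) (y n)) at_top sequentially"
    by (intro filterlim_tendsto_add_at_top[OF tendsto_const] p)
  then show "filterlim (\<lambda>n. gromov_product b (x n) (y n)) at_top sequentially"
  proof (rule filterlim_at_top_mono)
    show "\<forall>\<^sub>F n in sequentially.
        - dist p b + gromov_product p (x n) (y n) \<le> gromov_product b (x n) (y n)"
      by (intro always_eventually) (smt (verit) gromov_product_change_base)
  qed
next
  assume lim: "filterlim (\<lambda>n. gromov_product b (x n) (y n)) at_top sequentially"
  have "filterlim (\<lambda>n. dist (x n) b) at_top sequentially"
    by (rule filterlim_at_top_mono[OF lim]) (simp add: gromov_product_le_dist)
  then have x: "simple_end {A. bounded A} x" using simple_end_bounded_iff by blast
  have "filterlim (\<lambda>n. dist (y n) b) at_top sequentially"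
    by (rule filterlim_at_top_mono[OF lim])
       (simp add: gromov_product_commute[of b "x _"] gromov_product_le_dist)
  then have "simple_end {A. bounded A} y" using simple_end_bounded_iff by blast
  with x show "(x, y) \<in> end_equiv gromov_coarse"
    using lim unfolding gromov_coarse_def by auto
qed

text \<open>Otherwise pairs with product at least \<open>n\<close> and values
  \<open>\<epsilon>\<close> apart would form equivalent simple ends.\<close>

lemma slowly_oscillating_uniform:
  assumes "slowly_oscillating gromov_coarse f" "0 < \<epsilon>"
  obtains C where "\<And>u v. C \<le> gromov_product b u v \<Longrightarrow> dist (f u) (f v) < \<epsilon>"
proof -
  have "\<exists>C. \<forall>u v. C \<le> gromov_product b u v \<longrightarrow> dist (f u) (f v) < \<epsilon>"
  proof (rule ccontr)
    assume "\<not> ?thesis"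
    then have "\<forall>n::nat. \<exists>u v. real n \<le> gromov_product b u v \<and> \<epsilon> \<le> dist (f u) (f v)"
      by (meson not_le)
    then obtain u v where uv: "\<And>n. real n \<le> gromov_product b (u n) (v n)"
      "\<And>n. \<epsilon> \<le> dist (f (u n)) (f (v n))" by metis
    have "filterlim (\<lambda>n. gromov_product b (u n) (v n)) at_top sequentially"
      by (rule filterlim_at_top_mono[OF filterlim_real_sequentially]) (simp add: uv(1))
    then have "(\<lambda>n. dist (f (u n)) (f (v n))) \<longlonglongrightarrow> 0"
      using assms(1) end_equiv_gromov_coarse_iff unfolding slowly_oscillating_def by blast
    then have "\<forall>\<^sub>F n in sequentially. dist (f (u n)) (f (v n)) < \<epsilon>"
      using \<open>0 < \<epsilon>\<close> by (rule order_tendstoD)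
    then obtain n where "dist (f (u n)) (f (v n)) < \<epsilon>" unfolding eventually_sequentially by blast
    then show False using uv(2)[of n] by simp
  qed
  then show thesis using that by blast
qed

section \<open>Bump functions\<close>

definition bump :: "'a::metric_space \<Rightarrow> real \<Rightarrow> 'a \<Rightarrow> real" where
  "bump z r w = max 0 (1 - dist w z / r)"

text \<open>Simple ends eventually leave the ball of radius \<open>r\<close> around
  \<open>z\<close>, and the bump vanishes outside it.\<close>

lemma bump_admissible:
  assumes "0 < r"
  shows "range (bump z r) \<subseteq> {0..1}" "continuous_on UNIV (bump z r)"
    "slowly_oscillating gromov_coarse (bump z r)"
proof -
  show "range (bump z r) \<subseteq> {0..1}" using assms by (auto simp: bump_def)
  show "continuous_on UNIV (bump z r)"
    unfolding bump_def by (intro continuous_intros) (use assms in auto)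
  have ev: "\<forall>\<^sub>F n in sequentially. bump z r (x n) = 0" if "simple_end {A. bounded A} x" for x
  proof -
    have "\<forall>\<^sub>F n in sequentially. r \<le> dist (x n) z"
      using that unfolding simple_end_bounded_iff[of x z] filterlim_at_top by blast
    then show ?thesis
      by eventually_elim (use assms in \<open>simp add: bump_def\<close>)
  qed
  show "slowly_oscillating gromov_coarse (bump z r)"
    unfolding slowly_oscillating_def
  proof safe
    fix x y :: "nat \<Rightarrow> 'a"
    assume "(x, y) \<in> end_equiv gromov_coarse"
    then have "\<forall>\<^sub>F n in sequentially. bump z r (x n) = 0" "\<forall>\<^sub>F n in sequentially. bump z r (y n) = 0"
      using ev by (auto simp: gromov_coarse_def)
    then have "\<forall>\<^sub>F n in sequentially. dist (bump z r (x n)) (bump z r (y n)) = 0"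
      by eventually_elim simp
    then show "(\<lambda>n. dist (bump z r (x n)) (bump z r (y n))) \<longlonglongrightarrow> 0"
      by (rule tendsto_eventually)
  qed
qed

section \<open>Existence of the Higson compactification\<close>

text \<open>The pairs at which \<open>g\<close> differs by at least \<open>\<epsilon>\<close> form a
  compact set \<open>D\<close>, covered by the open sets \<open>W\<close> on which one coordinate
  differs by a definite amount. Finitely many suffice, and slow oscillation of those coordinates
  makes the pairs from equivalent ends eventually avoid \<open>D\<close>.\<close>

lemma slowly_oscillating_extension:
  fixes e :: "'a \<Rightarrow> ('a \<Rightarrow> real) \<Rightarrow> real"
  assumes comp: "compact_space K" and K: "K = subtopology (product_topology (\<lambda>_. euclideanreal) F) S"
    and e: "\<And>x. e x = (\<lambda>f\<in>F. f x)" "range e \<subseteq> topspace K"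
    and F: "\<And>f. f \<in> F \<Longrightarrow> slowly_oscillating \<C> f"
    and g: "continuous_map K euclideanreal g"
  shows "slowly_oscillating \<C> (\<lambda>x. g (e x))"
  unfolding slowly_oscillating_def
proof safe
  fix x y
  assume xy: "(x, y) \<in> end_equiv \<C>"
  show "(\<lambda>n. dist (g (e (x n))) (g (e (y n)))) \<longlonglongrightarrow> 0"
  proof (rule order_tendstoI)
    fix \<epsilon> :: real
    assume "0 < \<epsilon>"
    let ?KK = "prod_topology K K"
    define D where "D = {z \<in> topspace ?KK. g (fst z) - g (snd z) \<in> {..-\<epsilon>} \<union> {\<epsilon>..}}"
    define W where "W = (\<lambda>(f, \<eta>). {z \<in> topspace ?KK. fst z f - snd z f \<in> {..<-\<eta>} \<union> {\<eta><..}})"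
    have fst: "continuous_map ?KK K fst" and snd: "continuous_map ?KK K snd"
      by (simp_all add: continuous_map_fst continuous_map_snd)
    have coord: "continuous_map K euclideanreal (\<lambda>p. p f)" if "f \<in> F" for f
      
      unfolding K
      by (intro continuous_map_from_subtopology continuous_map_product_coordinates[OF that])
    have "closedin ?KK D"
      unfolding D_def
      by (rule closedin_continuous_map_preimage[where Y = euclideanreal])
        (auto intro!: continuous_map_diff continuous_map_compose[OF fst g, unfolded o_def]
          continuous_map_compose[OF snd g, unfolded o_def] closed_Un)
    then have D: "compactin ?KK D"
      using comp by (simp add: closedin_compact_space compact_space_prod_topology)
    have W: "openin ?KK (W i)" if i_in: "i \<in> F \<times> {0<..}" for i
    proof -
      obtain f \<eta> where i: "i = (f, \<eta>)" "f \<in> F" using i_in by auto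
      show ?thesis
        unfolding W_def i(1) prod.case
        by (rule openin_continuous_map_preimage[where Y = euclideanreal])
          (auto intro!: continuous_map_diff continuous_map_compose[OF fst coord[OF i(2)], unfolded o_def]
            continuous_map_compose[OF snd coord[OF i(2)], unfolded o_def])
    qed
    \<comment> \<open>Points of the product are extensional on \<open>F\<close>, so distinct ones
      differ at some \<open>f \<in> F\<close>; half the difference is a strict threshold.\<close>
    have cover: "D \<subseteq> \<Union> (W ` (F \<times> {0<..}))"
    proof
      fix z assume z: "z \<in> D"
      then have "fst z \<noteq> snd z" using \<open>0 < \<epsilon>\<close> unfolding D_def by auto
      moreover have "fst z \<in> extensional F" "snd z \<in> extensional F"
        using z unfolding D_def K by (auto simp: PiE_def)
      ultimately obtain f where f: "f \<in> F" "fst z f \<noteq> snd z f"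
        by (meson extensionalityI)
      define \<eta> where "\<eta> = \<bar>fst z f - snd z f\<bar> / 2"
      have "0 < \<eta>" using f(2) unfolding \<eta>_def by simp
      moreover from this have "fst z f - snd z f < - \<eta> \<or> \<eta> < fst z f - snd z f"
        unfolding \<eta>_def by (cases "fst z f < snd z f") (auto simp: field_simps)
      then have "z \<in> W (f, \<eta>)" using z unfolding W_def D_def by simp
      ultimately have "z \<in> W (f, \<eta>)" "0 < \<eta>" by blast+
      then show "z \<in> \<Union> (W ` (F \<times> {0<..}))" using f(1) by blast
    qed
    obtain \<F> where "finite \<F>" "\<F> \<subseteq> W ` (F \<times> {0<..})" "D \<subseteq> \<Union> \<F>"
      using compactinD[OF D _ cover] W by blast
    then obtain I where I: "finite I" "I \<subseteq> F \<times> {0<..}" "D \<subseteq> \<Union> (W ` I)"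
      using finite_subset_image[of \<F> W "F \<times> {0<..}"] by blast
    have "\<forall>\<^sub>F n in sequentially. (e (x n), e (y n)) \<notin> W i" if i_in: "i \<in> I" for i
    proof -
      obtain f \<eta> where i: "i = (f, \<eta>)" "f \<in> F" "0 < \<eta>" using i_in I(2) by auto
      have "(\<lambda>n. dist (f (x n)) (f (y n))) \<longlonglongrightarrow> 0"
        using F[OF i(2)] xy unfolding slowly_oscillating_def by blast
      then have "\<forall>\<^sub>F n in sequentially. dist (f (x n)) (f (y n)) < \<eta>"
        using i(3) by (rule order_tendstoD)
      then show ?thesis
        by eventually_elim (use i in \<open>auto simp: W_def e dist_real_def\<close>)
    qed
    then have "\<forall>\<^sub>F n in sequentially. \<forall>i\<in>I. (e (x n), e (y n)) \<notin> W i"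
      using I(1) by (simp add: eventually_ball_finite)
    then show "\<forall>\<^sub>F n in sequentially. dist (g (e (x n))) (g (e (y n))) < \<epsilon>"
    proof eventually_elim
      case (elim n)
      then have "(e (x n), e (y n)) \<notin> D" using I(3) by blast
      then show ?case using e(2) unfolding D_def by (auto simp: dist_real_def image_subset_iff)
    qed
  qed (auto intro!: always_eventually less_le_trans[OF _ zero_le_dist])
qed

text \<open>\<open>sep\<close> supplies enough coordinates for the evaluation map to be injective
  and open onto its image; a function in \<open>F\<close> extends as a coordinate
  projection.\<close>

lemma higson_compactification_exists:
  fixes \<C> :: "'a::t2_space coarse_data"
  assumes "simple_coarse_structure \<C>" "locally_compact_space (euclidean :: 'a topology)"
    and "bounded_sets \<C> = {A. compact (closure A)}"
    and sep: "\<And>x U. open U \<Longrightarrow> x \<in> U \<Longrightarrow>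
      \<exists>f :: 'a \<Rightarrow> real. range f \<subseteq> {0..1} \<and> continuous_on UNIV f \<and> slowly_oscillating \<C> f \<and>
        0 < f x \<and> (\<forall>y. y \<notin> U \<longrightarrow> f y = 0)"
  shows "\<exists>(K :: (('a \<Rightarrow> real) \<Rightarrow> real) topology) e. higson_compactification \<C> K e"
proof -
  define F where
    "F = {f :: 'a \<Rightarrow> real. range f \<subseteq> {0..1} \<and> continuous_on UNIV f \<and> slowly_oscillating \<C> f}"
  define P where "P = product_topology (\<lambda>_::'a \<Rightarrow> real. euclideanreal) F"
  define e where "e = (\<lambda>x::'a. \<lambda>f\<in>F. f x)"
  define K where "K = subtopology P (P closure_of range e)"
  have topP: "topspace P = extensional F" unfolding P_def by (simp add: PiE_def)
  have eP: "range e \<subseteq> topspace P" unfolding topP e_def by auto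
  have clo: "range e \<subseteq> P closure_of range e" using eP by (rule closure_of_subset)
  have topK: "topspace K = P closure_of range e"
    unfolding K_def by (simp add: closure_of_subset_topspace Int_absorb1)
  have eK: "range e \<subseteq> topspace K" using clo topK by simp
  have Q: "compactin P (\<Pi>\<^sub>E f\<in>F. {0..1})"
    unfolding P_def by (simp add: compactin_PiE)
  have "closedin P (\<Pi>\<^sub>E f\<in>F. {0..1})" unfolding P_def by (simp add: closedin_product_topology)
  moreover have "range e \<subseteq> (\<Pi>\<^sub>E f\<in>F. {0..1})"
    unfolding e_def F_def by (auto simp: image_subset_iff)
  ultimately have "P closure_of range e \<subseteq> (\<Pi>\<^sub>E f\<in>F. {0..1})" by (simp add: closure_of_minimal)
  then have "compactin P (P closure_of range e)" using Q by (meson closed_compactin closedin_closure_of)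
  then have compK: "compact_space K" unfolding K_def by (rule compact_space_subtopology)
  have "Hausdorff_space P" unfolding P_def by (simp add: Hausdorff_space_product_topology)
  then have hausK: "Hausdorff_space K" unfolding K_def by (rule Hausdorff_space_subtopology)
  have cont: "continuous_map euclidean P e"
    unfolding P_def continuous_map_componentwise by (auto simp: e_def F_def)
  have sub: "subtopology K (range e) = subtopology P (range e)"
    unfolding K_def using clo by (simp add: subtopology_subtopology Int_absorb1)
  have coord: "continuous_map P euclideanreal (\<lambda>p. p f)" if "f \<in> F" for f
    unfolding P_def by (rule continuous_map_product_coordinates[OF that])
  have ev: "\<exists>f\<in>F. 0 < f x \<and> (\<forall>y. y \<notin> U \<longrightarrow> f y = 0)" if "open U" "x \<in> U" for x U
    using sep[OF that] unfolding F_def by blast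
  \<comment> \<open>Positivity of the coordinate from \<open>sep\<close> cuts out a neighbourhood of
    \<open>e x\<close> that meets the image of \<open>e\<close> only inside the image of
    \<open>U\<close>.\<close>
  have "open_map euclidean (subtopology P (range e)) e"
    unfolding open_map_def
  proof (intro allI impI)
    fix U :: "'a set"
    assume U: "openin euclidean U"
    have "\<exists>T. openin (subtopology P (range e)) T \<and> e x \<in> T \<and> T \<subseteq> e ` U" if x: "x \<in> U" for x
    proof -
      obtain f where f: "f \<in> F" "0 < f x" "\<And>y. y \<notin> U \<Longrightarrow> f y = 0"
        using ev[of U x] U x by auto
      let ?V = "{p \<in> topspace P. p f \<in> {0<..}}"
      have "openin P ?V"
        by (rule openin_continuous_map_preimage[OF coord[OF f(1)]]) simp
      then have "openin (subtopology P (range e)) (?V \<inter> range e)"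
        by (rule openin_subtopology_Int)
      moreover have "e x \<in> ?V \<inter> range e" using f eP unfolding e_def by auto
      moreover have "?V \<inter> range e \<subseteq> e ` U" using f unfolding e_def by force
      ultimately show ?thesis by blast
    qed
    then show "openin (subtopology P (range e)) (e ` U)" by (subst openin_subopen) blast
  qed
  moreover have "inj e"
  proof (rule injI, rule ccontr)
    fix x y assume xy: "e x = e y" "x \<noteq> y"
    obtain f where "f \<in> F" "0 < f x" "f y = 0"
      using ev[of "- {y}" x] xy(2) by auto
    then show False using xy(1) unfolding e_def by (metis less_irrefl restrict_apply')
  qed
  ultimately have "homeomorphic_map euclidean (subtopology P (range e)) e"
    using cont eP
    by (intro bijective_open_imp_homeomorphic_map)
       (auto simp: continuous_map_in_subtopology)
  then have emb: "embedding_map euclidean K e" unfolding embedding_map_def by (simp add: sub)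
  have dense: "K closure_of range e = topspace K"
    unfolding topK K_def using clo by (simp add: closure_of_subtopology Int_absorb1 Int_absorb2 closure_of_subset_topspace)
  have "(\<exists>g. continuous_map K (top_of_set {0..1}) g \<and> (\<forall>x. g (e x) = f x)) \<longleftrightarrow>
      continuous_on UNIV f \<and> slowly_oscillating \<C> f" if rf: "range f \<subseteq> {0..1}" for f :: "'a \<Rightarrow> real"
  proof
    assume "\<exists>g. continuous_map K (top_of_set {0..1}) g \<and> (\<forall>x. g (e x) = f x)"
    then obtain g where g: "continuous_map K euclideanreal g" "f = (\<lambda>x. g (e x))"
      unfolding continuous_map_in_subtopology by auto
    have "slowly_oscillating \<C> f"
      unfolding g(2)
    proof (rule slowly_oscillating_extension[OF compK K_def[unfolded P_def] _ eK _ g(1)])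
      show "e x = (\<lambda>f\<in>F. f x)" for x by (simp add: e_def)
      show "slowly_oscillating \<C> f" if "f \<in> F" for f using that by (simp add: F_def)
    qed
    moreover have "continuous_map euclidean K e"
      unfolding K_def continuous_map_in_subtopology using cont clo by auto
    from continuous_map_compose[OF this g(1)] have "continuous_on UNIV f"
      unfolding g(2) by (simp add: o_def)
    ultimately show "continuous_on UNIV f \<and> slowly_oscillating \<C> f" by blast
  next
    assume "continuous_on UNIV f \<and> slowly_oscillating \<C> f"
    then have f: "f \<in> F" using rf by (simp add: F_def)
    have "continuous_map K euclideanreal (\<lambda>p. p f)"
      unfolding K_def using coord[OF f] by (rule continuous_map_from_subtopology)
    moreover have "p f \<in> {0..1}" if "p \<in> topspace K" for p
      using that \<open>P closure_of range e \<subseteq> _\<close> f unfolding topK by blast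
    ultimately have "continuous_map K (top_of_set {0..1}) (\<lambda>p. p f)"
      unfolding continuous_map_in_subtopology by blast
    moreover have "\<forall>x. e x f = f x" using f by (simp add: e_def)
    ultimately show "\<exists>g. continuous_map K (top_of_set {0..1}) g \<and> (\<forall>x. g (e x) = f x)" by blast
  qed
  then show ?thesis
    using assms(1-3) compK hausK emb dense
    unfolding higson_compactification_def compactification_def by blast
qed

section \<open>Slowly oscillating functions separating boundary points\<close>

text \<open>\<open>k\<close> stands for \<open>\<delta> / 4\<close>, and \<open>a\<close> is the
  base point of the boundary.\<close>

locale gromov_hyperbolic_base =
  fixes k :: real and a :: "'a::metric_space"
  assumes k_pos: "0 < k"
    and hyp: "min (gromov_product a x z) (gromov_product a z y) - k \<le> gromov_product a x y"
begin

section \<open>Boundary points as classes of sequences\<close>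

lemma equiv_boundary_equiv: "equiv (converging_to_infinity a) (boundary_equiv a)"
proof (rule equivI)
  show "boundary_equiv a \<subseteq> converging_to_infinity a \<times> converging_to_infinity a"
    unfolding boundary_equiv_def by auto
  show "refl_on (converging_to_infinity a) (boundary_equiv a)"
    unfolding boundary_equiv_def refl_on_def by (auto simp: converging_to_infinity_def)
  show "sym (boundary_equiv a)"
    unfolding boundary_equiv_def using gromov_liminf_commute by (auto intro!: symI)
  show "trans (boundary_equiv a)"
  proof (rule transI)
    fix x y z
    assume xy: "(x, y) \<in> boundary_equiv a" and yz: "(y, z) \<in> boundary_equiv a"
    have "gromov_liminf a x z = \<infinity>"
      unfolding gromov_liminf_eq_infinity_iff
    proof
      fix C
      obtain M where M: "\<And>i j. M \<le> i \<Longrightarrow> M \<le> j \<Longrightarrow> C + k \<le> gromov_product a (x i) (y j)"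
        using xy unfolding boundary_equiv_def gromov_liminf_eq_infinity_iff by blast
      obtain N where N: "\<And>i j. N \<le> i \<Longrightarrow> N \<le> j \<Longrightarrow> C + k \<le> gromov_product a (y i) (z j)"
        using yz unfolding boundary_equiv_def gromov_liminf_eq_infinity_iff by blast
      have "C \<le> gromov_product a (x i) (z j)" if "max M N \<le> i" "max M N \<le> j" for i j
        using M[of i i] N[of i j] hyp[of "x i" "y i" "z j"] that by simp
      then show "\<exists>N. \<forall>i\<ge>N. \<forall>j\<ge>N. C \<le> gromov_product a (x i) (z j)" by blast
    qed
    then show "(x, z) \<in> boundary_equiv a" using xy yz unfolding boundary_equiv_def by simp
  qed
qed

lemma boundary_points_subset: "P \<in> gromov_boundary_points a \<Longrightarrow> P \<subseteq> converging_to_infinity a"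
  unfolding gromov_boundary_points_def
  using equiv_boundary_equiv by (metis Union_quotient Union_upper)

lemma boundary_points_nonempty: "P \<in> gromov_boundary_points a \<Longrightarrow> P \<noteq> {}"
  unfolding gromov_boundary_points_def using equiv_boundary_equiv in_quotient_imp_non_empty by blast

lemma boundary_points_liminf:
  assumes "P \<in> gromov_boundary_points a" "x \<in> P" "y \<in> P"
  shows "gromov_liminf a x y = \<infinity>"
  using in_quotient_imp_in_rel[OF equiv_boundary_equiv, of P x y] assms
  unfolding gromov_boundary_points_def boundary_equiv_def by simp

lemma boundary_points_eqI:
  assumes "P \<in> gromov_boundary_points a" "Q \<in> gromov_boundary_points a" "x \<in> P" "y \<in> Q"
    and "gromov_liminf a x y = \<infinity>"
  shows "P = Q"
proof -
  have "(x, y) \<in> boundary_equiv a"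
    using boundary_points_subset assms unfolding boundary_equiv_def by blast
  then show ?thesis
    using quotient_eqI[OF equiv_boundary_equiv] assms unfolding gromov_boundary_points_def by blast
qed

lemma boundary_point_exists:
  assumes "x \<in> converging_to_infinity a"
  obtains P where "P \<in> gromov_boundary_points a" "x \<in> P"
  using equiv_class_self[OF equiv_boundary_equiv assms] quotientI[OF assms]
  unfolding gromov_boundary_points_def by blast

text \<open>The square root and the choice of \<open>scale\<close> make \<open>quasi_dist\<close> a quasi-ultrametric with constant
  \<open>sqrt 2\<close>, so that the four-point inequality has the constant 2 required for chains.\<close>

definition scale :: real where "scale = ln 2 / (2 * (1 + k))"

definition quasi_dist :: "'a \<Rightarrow> 'a \<Rightarrow> real" where
  "quasi_dist x y = min (sqrt (dist x y)) (exp (- scale * gromov_product a x y))"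

lemma scale_pos: "0 < scale"
  unfolding scale_def using k_pos by simp

text \<open>Since \<open>scale * (1 + k)\<close> is \<open>ln (sqrt 2)\<close>, losing
  \<open>1 + k\<close> in a product costs at most a factor \<open>sqrt 2\<close>. The allowance
  covers \<open>k\<close> from hyperbolicity and 1 from moving a point by at most 1.\<close>

lemma exp_scale_le:
  assumes "g - t \<le> h" "t \<le> 1 + k"
  shows "exp (- scale * h) \<le> sqrt 2 * exp (- scale * g)"
proof -
  have "scale * t \<le> scale * (1 + k)" using scale_pos assms(2) by simp
  also have "\<dots> = ln (sqrt 2)" unfolding scale_def using k_pos by (simp add: ln_sqrt field_simps)
  finally have t: "scale * t \<le> ln (sqrt 2)" .
  have "scale * (g - t) \<le> scale * h" using scale_pos assms(1) by simp
  then have "- scale * h \<le> ln (sqrt 2) + - scale * g" using t by (simp add: algebra_simps)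
  then have "exp (- scale * h) \<le> exp (ln (sqrt 2) + - scale * g)" by simp
  also have "\<dots> = sqrt 2 * exp (- scale * g)" unfolding exp_add by simp
  finally show ?thesis .
qed

section \<open>The quasi-ultrametric inequality\<close>

lemma quasi_dist_nonneg: "0 \<le> quasi_dist x y"
  by (simp add: quasi_dist_def)

lemma quasi_dist_le_1: "quasi_dist x y \<le> 1"
  unfolding quasi_dist_def using scale_pos gromov_product_nonneg[of a x y]
  by (intro min.coboundedI2) simp

lemma quasi_dist_refl: "quasi_dist x x = 0"
  by (simp add: quasi_dist_def)

lemma quasi_dist_commute: "quasi_dist x y = quasi_dist y x"
  by (simp add: quasi_dist_def dist_commute gromov_product_commute)

lemma quasi_dist_mixed:
  assumes "sqrt (dist x z) \<le> 1"
  shows "quasi_dist x y \<le> sqrt 2 * exp (- scale * gromov_product a z y)"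
proof -
  have "exp (- scale * gromov_product a x y) \<le> sqrt 2 * exp (- scale * gromov_product a z y)"
    using assms k_pos gromov_product_diff_le[of a z y x]
    by (intro exp_scale_le[of _ "dist x z"]) auto
  then show ?thesis unfolding quasi_dist_def by simp
qed

text \<open>Cases by which term attains each minimum. Two distances use the triangle inequality, two
  products hyperbolicity. In a mixed case the bound \<open>quasi_dist_le_1\<close> makes the
  distance at most 1, so that moving by it changes the product by at most 1.\<close>

lemma quasi_dist_quasi_ultrametric:
  "quasi_dist x y \<le> sqrt 2 * max (quasi_dist x z) (quasi_dist z y)"
proof -
  let ?M = "max (quasi_dist x z) (quasi_dist z y)"
  consider (dd) "quasi_dist x z = sqrt (dist x z)" "quasi_dist z y = sqrt (dist z y)"
    | (de) "quasi_dist x z = sqrt (dist x z)"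
        "quasi_dist z y = exp (- scale * gromov_product a z y)"
    | (ed) "quasi_dist x z = exp (- scale * gromov_product a x z)"
        "quasi_dist z y = sqrt (dist z y)"
    | (ee) "quasi_dist x z = exp (- scale * gromov_product a x z)"
        "quasi_dist z y = exp (- scale * gromov_product a z y)"
    unfolding quasi_dist_def min_def by argo
  then show ?thesis
  proof cases
    case dd
    have "dist x y \<le> 2 * max (dist x z) (dist z y)"
      using dist_triangle[of x y z] by linarith
    then have "sqrt (dist x y) \<le> sqrt (2 * max (dist x z) (dist z y))" by simp
    also have "\<dots> = sqrt 2 * ?M"
      unfolding dd real_sqrt_mult by (simp add: max_def)
    finally show ?thesis unfolding quasi_dist_def[of x y] by simp
  next
    case de
    then have "quasi_dist x y \<le> sqrt 2 * quasi_dist z y"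
      using quasi_dist_mixed[of x z y] quasi_dist_le_1[of x z] by simp
    also have "\<dots> \<le> sqrt 2 * ?M" by (intro mult_left_mono) auto
    finally show ?thesis .
  next
    case ed
    then have "quasi_dist y x \<le> sqrt 2 * quasi_dist x z"
      using quasi_dist_mixed[of y z x] quasi_dist_le_1[of z y]
      by (simp add: dist_commute gromov_product_commute)
    also have "\<dots> \<le> sqrt 2 * ?M" by (intro mult_left_mono) auto
    finally show ?thesis by (simp add: quasi_dist_commute)
  next
    case ee
    have "quasi_dist x y \<le> exp (- scale * gromov_product a x y)" by (simp add: quasi_dist_def)
    also have "\<dots> \<le> sqrt 2 * exp (- scale * min (gromov_product a x z) (gromov_product a z y))"
      using hyp[of x z y] by (intro exp_scale_le[of _ k]) auto
    also have "exp (- scale * min (gromov_product a x z) (gromov_product a z y)) \<le> ?M"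
      unfolding ee by (simp add: min_def)
    finally show ?thesis by simp
  qed
qed

text \<open>Two uses of the three-point inequality, with \<open>sqrt 2 * sqrt 2 = 2\<close>.\<close>

lemma quasi_dist_4_points:
  "quasi_dist x w \<le> 2 * max (quasi_dist x y) (max (quasi_dist y z) (quasi_dist z w))"
proof -
  let ?M = "max (quasi_dist y z) (quasi_dist z w)"
  have s: "1 \<le> sqrt 2" by simp
  have M: "0 \<le> ?M" using quasi_dist_nonneg[of y z] by linarith
  have "quasi_dist x w \<le> sqrt 2 * max (quasi_dist x y) (quasi_dist y w)"
    by (rule quasi_dist_quasi_ultrametric)
  also have "max (quasi_dist x y) (quasi_dist y w) \<le> max (sqrt 2 * quasi_dist x y) (sqrt 2 * ?M)"
    using quasi_dist_quasi_ultrametric[of y w z] mult_right_mono[OF s quasi_dist_nonneg[of x y]]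
    by (intro max.mono) auto
  also have "\<dots> = sqrt 2 * max (quasi_dist x y) ?M" by (simp add: max_mult_distrib_left)
  finally have "quasi_dist x w \<le> sqrt 2 * (sqrt 2 * max (quasi_dist x y) ?M)" by simp
  then show ?thesis by (simp add: mult.assoc[symmetric])
qed

text \<open>\<open>f\<close> is the chain distance to a tail of \<open>x\<close>. The square root in
  \<open>quasi_dist\<close> makes it continuous, the exponential slowly oscillating, and Frink's
  bound keeps it away from 0 along \<open>y\<close>.\<close>

lemma separating_function:
  assumes x: "x \<in> converging_to_infinity a"
  obtains f c where "range f \<subseteq> {0..1::real}" "continuous_on UNIV f"
    "slowly_oscillating gromov_coarse f" "0 < c" "\<forall>\<^sub>F i in sequentially. f (x i) = 0"
    "\<And>y. y \<in> converging_to_infinity a \<Longrightarrow> \<not> ereal r \<le> gromov_liminf a x y \<Longrightarrow>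
      \<forall>\<^sub>F j in sequentially. c \<le> f (y j)"
proof -
  \<comment> \<open>The tails have products at least \<open>R\<close>, which leaves room for two
    uses of hyperbolicity at cost \<open>k\<close> each; the extra 1 will keep tail points of
    \<open>x\<close> and \<open>y\<close> at distance at least 1.\<close>
  define R where "R = r + 2 * k + 1"
  define c where "c = min 1 (exp (- scale * (r + 2 * k)))"
  obtain J where J: "\<And>i j. J \<le> i \<Longrightarrow> J \<le> j \<Longrightarrow> R \<le> gromov_product a (x i) (x j)"
    using x unfolding converging_to_infinity_iff by blast
  obtain f where lip: "\<And>z w. \<bar>f z - f w\<bar> \<le> quasi_dist z w"
    and zero: "\<And>z. z \<in> x ` {J..} \<Longrightarrow> f z = 0" and rf: "range f \<subseteq> {0..1}"
    and lower: "\<And>z c. (\<And>w. w \<in> x ` {J..} \<Longrightarrow> c \<le> quasi_dist z w) \<Longrightarrow> c / 2 \<le> f z"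
    using chain_distance_exists[of quasi_dist "x ` {J..}", OF quasi_dist_nonneg quasi_dist_refl
        quasi_dist_commute quasi_dist_4_points quasi_dist_le_1] by blast
  have cont: "continuous_on UNIV f"
    unfolding continuous_on_def
  proof
    fix z :: 'a
    have "((\<lambda>w. sqrt (dist w z)) \<longlongrightarrow> 0) (at z)"
      by (rule tendsto_eq_intros refl | simp)+
    then have "((\<lambda>w. f w - f z) \<longlongrightarrow> 0) (at z)"
      by (rule Lim_null_comparison[rotated])
         (use lip in \<open>auto simp: quasi_dist_def intro!: always_eventually\<close>)
    then show "(f \<longlongrightarrow> f z) (at z)" by (simp add: LIM_zero_iff)
  qed
  have osc: "slowly_oscillating gromov_coarse f"
    unfolding slowly_oscillating_def
  proof safe
    fix u v
    assume "(u, v) \<in> end_equiv (gromov_coarse :: 'a coarse_data)"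
    then have "filterlim (\<lambda>n. scale * gromov_product a (u n) (v n)) at_top sequentially"
      using filterlim_tendsto_pos_mult_at_top[OF tendsto_const scale_pos] 
      by (simp add: end_equiv_gromov_coarse_iff[of _ _ a])
    then have "(\<lambda>n. exp (- (scale * gromov_product a (u n) (v n)))) \<longlonglongrightarrow> 0"
      by (intro filterlim_compose[OF exp_at_bot] filterlim_uminus_at_bot_at_top[THEN filterlim_compose])
    then show "(\<lambda>n. dist (f (u n)) (f (v n))) \<longlonglongrightarrow> 0"
      by (rule Lim_null_comparison[rotated])
         (use lip in \<open>auto simp: quasi_dist_def dist_real_def intro!: always_eventually\<close>)
  qed
  have far: "\<forall>\<^sub>F j in sequentially. c / 2 \<le> f (y j)"
    if y: "y \<in> converging_to_infinity a" and xy: "\<not> ereal r \<le> gromov_liminf a x y" for y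
  proof -
    obtain N where N: "\<And>i j. N \<le> i \<Longrightarrow> N \<le> j \<Longrightarrow> R \<le> gromov_product a (y i) (y j)"
      using y unfolding converging_to_infinity_iff by blast
    \<comment> \<open>One tail pair with product at least \<open>r + 2 * k\<close> would, through
      both tails, force product at least \<open>r\<close> on all later pairs and hence on the
      liminf.\<close>
    have small: "gromov_product a (x i) (y j) < r + 2 * k" if ij: "J \<le> i" "N \<le> j" for i j
    proof (rule ccontr)
      assume "\<not> ?thesis"
      then have large: "r + 2 * k \<le> gromov_product a (x i) (y j)" by simp
      have "r \<le> gromov_product a (x i') (y j')" if "max J N \<le> i'" "max J N \<le> j'" for i' j'
      proof -
        have "r + k \<le> gromov_product a (x i') (y j)"
          using hyp[of "x i'" "x i" "y j"] J[of i' i] ij large that unfolding R_def by simp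
        then show ?thesis
          using hyp[of "x i'" "y j" "y j'"] N[of j j'] ij k_pos that unfolding R_def by simp
      qed
      then show False using gromov_liminf_geI xy by blast
    qed
    have "c \<le> quasi_dist (y j) (x i)" if ij: "J \<le> i" "N \<le> j" for i j
    proof -
      \<comment> \<open>The product of \<open>x i\<close> with itself is its distance to
        \<open>a\<close>, at least \<open>R\<close>; its product with \<open>y j\<close> is below
        \<open>R - 1\<close>.\<close>
      have "1 \<le> dist (x i) (y j)"
        using gromov_product_ge_dist_diff[of "x i" a "y j"] small[OF ij] J[OF ij(1) ij(1)]
          gromov_product_le_dist[of a "x i" "x i"] unfolding R_def by linarith
      moreover have "exp (- scale * (r + 2 * k)) \<le> exp (- scale * gromov_product a (x i) (y j))"
        using small[OF ij] scale_pos by simp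
      ultimately show ?thesis
        unfolding quasi_dist_def c_def gromov_product_commute[of a "y j"] dist_commute[of "y j"]
        by (intro min.mono) auto
    qed
    then have "c / 2 \<le> f (y j)" if "N \<le> j" for j using lower[of c "y j"] that by blast
    then show ?thesis unfolding eventually_sequentially by blast
  qed
  have "\<forall>\<^sub>F i in sequentially. f (x i) = 0"
    unfolding eventually_sequentially using zero by blast
  moreover have "0 < c / 2" unfolding c_def by simp
  ultimately show thesis using that rf cont osc far by blast
qed

end

text \<open>A geodesic from \<open>a\<close> to a far point crosses the sphere of radius
  \<open>T\<close>. Finitely many balls of radius 1/2 cover \<open>cball a T\<close>, and far points
  are grouped by the ball containing their crossing point. Crossing points in one group are at most
  1 apart, so the products are at least \<open>T - 1 / 2\<close>.\<close>

lemma finite_gromov_cover: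
  assumes "proper_metric TYPE('a::metric_space)" "geodesic_metric TYPE('a)"
  obtains \<V> where "finite \<V>" "- cball (a::'a) (\<bar>R\<bar> + 1) \<subseteq> \<Union>\<V>"
    "\<And>V u v. V \<in> \<V> \<Longrightarrow> u \<in> V \<Longrightarrow> v \<in> V \<Longrightarrow> R \<le> gromov_product a u v"
proof -
  define T where "T = \<bar>R\<bar> + 1"
  \<comment> \<open>\<open>c\<close> stands for the crossing point; of the geodesic only the
    remaining distance to \<open>u\<close> is recorded.\<close>
  define V where "V = (\<lambda>s. {u. \<exists>c. dist c u \<le> dist a u - T \<and> dist s c < 1 / 2})"
  have "compact (cball a T)" using assms(1) by (simp add: proper_metric_def)
  then obtain S where S: "finite S" "cball a T \<subseteq> (\<Union>s\<in>S. ball s (1 / 2))"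
    
    by (rule compactE_image[where f = "\<lambda>s. ball s (1/2)" and C = UNIV])
       (auto intro!: exI[of "\<lambda>y. dist y x * 2 < 1" x for x])
  have "u \<in> \<Union> (V ` S)" if u: "T < dist a u" for u
  proof -
    obtain c where c: "c 0 = a" "c (dist a u) = u"
      "\<And>s t. s \<in> {0..dist a u} \<Longrightarrow> t \<in> {0..dist a u} \<Longrightarrow> dist (c s) (c t) = \<bar>s - t\<bar>"
      using assms(2) unfolding geodesic_metric_def by metis
    have T: "0 \<le> T" by (simp add: T_def)
    have "dist (c 0) (c T) = T" "dist (c T) (c (dist a u)) = dist a u - T"
      using c(3)[of 0 T] c(3)[of T "dist a u"] T u by auto
    then have d: "dist a (c T) = T" "dist (c T) u = dist a u - T" unfolding c(1,2) .
    then obtain s where s: "s \<in> S" "dist s (c T) < 1 / 2" using S(2) by force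
    then have "u \<in> V s" unfolding V_def using d(2) by (intro CollectI exI[of _ "c T"]) simp
    then show ?thesis using s(1) by blast
  qed
  then have "- cball a (\<bar>R\<bar> + 1) \<subseteq> \<Union> (V ` S)" by (auto simp: T_def)
  moreover have "R \<le> gromov_product a u v" if u: "u \<in> V s" and v: "v \<in> V s" for s u v
  proof -
    obtain c where c: "dist c u \<le> dist a u - T" "dist s c < 1 / 2" using u unfolding V_def by blast
    obtain d where d: "dist d v \<le> dist a v - T" "dist s d < 1 / 2" using v unfolding V_def by blast
    have "dist u v \<le> dist c u + dist c d + dist d v"
      using dist_triangle[of u v c] dist_triangle[of c v d] by (simp add: dist_commute)
    moreover have "dist c d \<le> 1"
      using dist_triangle[of c d s] c(2) d(2) by (simp add: dist_commute)
    ultimately show ?thesis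
      using c(1) d(1) unfolding gromov_product_def T_def by (simp add: dist_commute abs_if split: if_splits)
  qed
  ultimately show thesis using that[of "V ` S"] S(1) by blast
qed

section \<open>The corona of a Higson compactification\<close>

locale gromov_higson = gromov_hyperbolic_base k a for k and a :: "'a::metric_space" +
  fixes K :: "'k topology" and e :: "'a \<Rightarrow> 'k"
  assumes higson: "higson_compactification gromov_coarse K e"
    and proper: "proper_metric TYPE('a)"
    and geodesic: "geodesic_metric TYPE('a)"
begin

abbreviation unit_map :: "('k \<Rightarrow> real) \<Rightarrow> bool" where
  "unit_map g \<equiv> continuous_map K (top_of_set {0..1}) g"

section \<open>Continuous functions on the compactification\<close>

lemma
  shows compact_K: "compact_space K" and Hausdorff_K: "Hausdorff_space K"
    and embedding_e: "embedding_map euclidean K e"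
    and dense_e: "K closure_of range e = topspace K"
  using higson unfolding higson_compactification_def compactification_def by auto

lemma continuous_e: "continuous_map euclidean K e"
  using embedding_e homeomorphic_imp_continuous_map
  unfolding embedding_map_def by (metis continuous_map_into_fulltopology)

lemma e_in_K: "e x \<in> topspace K"
  using continuous_map_image_subset_topspace[OF continuous_e] by auto

lemma extend:
  assumes "range f \<subseteq> {0..1}" "continuous_on UNIV f" "slowly_oscillating gromov_coarse f"
  obtains g where "unit_map g" "\<And>x. g (e x) = f x"
  using higson assms unfolding higson_compactification_def by metis

lemma unit_map_range: "unit_map g \<Longrightarrow> p \<in> topspace K \<Longrightarrow> g p \<in> {0..1}"
  by (auto simp: continuous_map_in_subtopology)

text \<open>The extension property read backwards: a continuous function on \<open>K\<close>
  restricts to a slowly oscillating one.\<close>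

lemma unit_map_uniform:
  assumes g: "unit_map g" and "0 < \<epsilon>"
  obtains C where "\<And>u v. C \<le> gromov_product a u v \<Longrightarrow> \<bar>g (e u) - g (e v)\<bar> < \<epsilon>"
proof -
  have "range (\<lambda>x. g (e x)) \<subseteq> {0..1}" using unit_map_range[OF g] e_in_K by blast
  then have "slowly_oscillating gromov_coarse (\<lambda>x. g (e x))"
    using g higson unfolding higson_compactification_def by metis
  from slowly_oscillating_uniform[OF this \<open>0 < \<epsilon>\<close>, of a] show thesis
    using that unfolding dist_real_def by metis
qed

lemma Urysohn_point:
  assumes "openin K U" "p \<in> U"
  obtains g where "unit_map g" "g p = 0" "\<And>q. q \<in> topspace K \<Longrightarrow> q \<notin> U \<Longrightarrow> g q = 1"
proof -
  have "completely_regular_space K"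
    using compact_K Hausdorff_K
    by (simp add: compact_Hausdorff_or_regular_imp_normal_space normal_imp_completely_regular_space)
  moreover have "closedin K (topspace K - U)" "p \<in> topspace K - (topspace K - U)"
    using assms openin_subset by fastforce+
  ultimately obtain g where "unit_map g" "g p = 0" "g ` (topspace K - U) \<subseteq> {1}"
    unfolding completely_regular_space_def by meson
  then show thesis using that by blast
qed

section \<open>Limits of sequences converging to infinity\<close>

lemma unit_map_limit:
  assumes "unit_map g" "limitin K (\<lambda>n. e (x n)) p sequentially"
  shows "(\<lambda>n. g (e (x n))) \<longlonglongrightarrow> g p"
proof -
  have "continuous_map K euclideanreal g" using assms(1) by (simp add: continuous_map_in_subtopology)
  from continuous_map_limit[OF this assms(2)] show ?thesis by (simp add: o_def)
qed

text \<open>Compactness gives a cluster point. A Urysohn function is small at some late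
  \<open>x m\<close>, and large mutual products keep it below 1 on a whole tail, which therefore
  lies in the given neighbourhood.\<close>

lemma limit_exists:
  assumes x: "x \<in> converging_to_infinity a"
  obtains p where "limitin K (\<lambda>n. e (x n)) p sequentially"
proof -
  \<comment> \<open>Open sets that the sequence eventually avoids; a point outside all of them is a
    cluster point.\<close>
  define \<U> where "\<U> = {U. openin K U \<and> (\<forall>\<^sub>F n in sequentially. e (x n) \<notin> U)}"
  have "\<not> topspace K \<subseteq> \<Union>\<U>"
  proof
    assume "topspace K \<subseteq> \<Union>\<U>"
    moreover have "compactin K (topspace K)" using compact_K by (simp add: compact_space_def)
    ultimately obtain \<F> where \<F>: "finite \<F>" "\<F> \<subseteq> \<U>" "topspace K \<subseteq> \<Union>\<F>"
      using compactinD[of K "topspace K" \<U>] unfolding \<U>_def by blast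
    have "\<forall>\<^sub>F n in sequentially. \<forall>U\<in>\<F>. e (x n) \<notin> U"
      using \<F>(1,2) unfolding \<U>_def by (intro eventually_ball_finite) auto
    then have "\<forall>\<^sub>F n in sequentially. False"
      by eventually_elim (use \<F>(3) e_in_K in blast)
    then show False by simp
  qed
  then obtain p where p: "p \<in> topspace K" "p \<notin> \<Union>\<U>" by blast
  have "\<forall>\<^sub>F n in sequentially. e (x n) \<in> U" if U: "openin K U" "p \<in> U" for U
  proof -
    obtain g where g: "unit_map g" "g p = 0" "\<And>q. q \<in> topspace K \<Longrightarrow> q \<notin> U \<Longrightarrow> g q = 1"
      using Urysohn_point[OF U] by blast
    obtain C where C: "\<And>u v. C \<le> gromov_product a u v \<Longrightarrow> \<bar>g (e u) - g (e v)\<bar> < 1 / 2"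
      using unit_map_uniform[OF g(1), of "1/2"] by auto
    obtain N where N: "\<And>i j. N \<le> i \<Longrightarrow> N \<le> j \<Longrightarrow> C \<le> gromov_product a (x i) (x j)"
      using x unfolding converging_to_infinity_iff by blast
    let ?V = "{q \<in> topspace K. g q \<in> {..<1/2}}"
    have "openin K ?V"
      using g(1) by (intro openin_continuous_map_preimage[where Y = euclideanreal])
        (auto simp: continuous_map_in_subtopology)
    moreover have "p \<in> ?V" using g(2) p(1) by simp
    ultimately have "\<not> (\<forall>\<^sub>F n in sequentially. e (x n) \<notin> ?V)"
      using p(2) unfolding \<U>_def by blast
    then obtain m where m: "N \<le> m" "g (e (x m)) < 1 / 2"
      unfolding eventually_sequentially by auto
    have "e (x i) \<in> U" if "N \<le> i" for i
      using C[OF N[OF that m(1)]] m(2) g(3)[of "e (x i)"] e_in_K by fastforce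
    then show ?thesis unfolding eventually_sequentially by blast
  qed
  then show thesis using that p(1) unfolding limitin_def by blast
qed

text \<open>A function separating the limits would take close values along \<open>x\<close> and
  \<open>y\<close>, because their products diverge.\<close>

lemma limits_eq:
  assumes x: "limitin K (\<lambda>n. e (x n)) p sequentially" and y: "limitin K (\<lambda>n. e (y n)) q sequentially"
    and xy: "gromov_liminf a x y = \<infinity>"
  shows "p = q"
proof (rule ccontr)
  assume "p \<noteq> q"
  have pq: "p \<in> topspace K" "q \<in> topspace K" using limitin_topspace[OF x] limitin_topspace[OF y] .
  have "openin K (topspace K - {q})"
    using Hausdorff_K by (simp add: closedin_Hausdorff_singleton pq(2) openin_diff)
  then obtain g where g: "unit_map g" "g p = 0" "g q = 1"
    using Urysohn_point[of "topspace K - {q}" p] pq \<open>p \<noteq> q\<close> by (metis DiffD2 DiffI singletonD singletonI)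
  obtain C where C: "\<And>u v. C \<le> gromov_product a u v \<Longrightarrow> \<bar>g (e u) - g (e v)\<bar> < 1 / 2"
    using unit_map_uniform[OF g(1), of "1/2"] by auto
  obtain N where N: "\<And>i j. N \<le> i \<Longrightarrow> N \<le> j \<Longrightarrow> C \<le> gromov_product a (x i) (y j)"
    using xy unfolding gromov_liminf_eq_infinity_iff by blast
  have "(\<lambda>n. \<bar>g (e (x n)) - g (e (y n))\<bar>) \<longlonglongrightarrow> \<bar>g p - g q\<bar>"
    by (intro tendsto_intros unit_map_limit[OF g(1)] x y)
  moreover have "\<forall>n\<ge>N. \<bar>g (e (x n)) - g (e (y n))\<bar> \<le> 1 / 2"
    using C N by (meson less_imp_le)
  ultimately have "\<bar>g p - g q\<bar> \<le> 1 / 2" using LIMSEQ_le_const2 by blast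
  then show False using g by simp
qed

text \<open>If the limit were \<open>e z\<close>, the extended bump at \<open>z\<close> would keep
  the sequence near \<open>z\<close>, while its distances to \<open>a\<close> diverge.\<close>

lemma limit_in_corona:
  assumes x: "x \<in> converging_to_infinity a" and p: "limitin K (\<lambda>n. e (x n)) p sequentially"
  shows "p \<notin> range e"
proof
  assume "p \<in> range e"
  then obtain z where z: "p = e z" by blast
  obtain g where g: "unit_map g" "\<And>w. g (e w) = bump z 1 w"
    using extend bump_admissible[of 1 z] by (metis zero_less_one)
  have "(\<lambda>n. bump z 1 (x n)) \<longlonglongrightarrow> bump z 1 z"
    using unit_map_limit[OF g(1) p] by (simp add: g(2) z)
  then have "\<forall>\<^sub>F n in sequentially. 0 < bump z 1 (x n)"
    by (rule order_tendstoD) (simp add: bump_def)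
  then obtain N where N: "\<And>n. N \<le> n \<Longrightarrow> dist (x n) z < 1"
    unfolding eventually_sequentially bump_def by (fastforce simp: less_max_iff_disj)
  obtain M where M: "\<And>i. M \<le> i \<Longrightarrow> 1 + dist z a \<le> gromov_product a (x i) (x i)"
    using x unfolding converging_to_infinity_iff by blast
  show False
    using N[of "max M N"] M[of "max M N"] gromov_product_le_dist[of a "x (max M N)" "x (max M N)"]
      dist_triangle[of "x (max M N)" a z] by simp
qed

section \<open>The map from the Gromov boundary to the corona\<close>

definition boundary_map :: "(nat \<Rightarrow> 'a) set \<Rightarrow> 'k" where
  "boundary_map P = (THE p. \<forall>x\<in>P. limitin K (\<lambda>n. e (x n)) p sequentially)"

lemma limitin_boundary_map:
  assumes P: "P \<in> gromov_boundary_points a" and x: "x \<in> P"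
  shows "limitin K (\<lambda>n. e (x n)) (boundary_map P) sequentially"
proof -
  have lim: "\<exists>q. limitin K (\<lambda>n. e (y n)) q sequentially" if "y \<in> P" for y
    using that limit_exists boundary_points_subset[OF P] by (meson subsetD)
  obtain p where p: "limitin K (\<lambda>n. e (x n)) p sequentially" using lim[OF x] by blast
  have "limitin K (\<lambda>n. e (y n)) p sequentially" if y: "y \<in> P" for y
    using lim[OF y] limits_eq[OF p _ boundary_points_liminf[OF P x y]] by blast
  moreover have "q = p" if "\<forall>y\<in>P. limitin K (\<lambda>n. e (y n)) q sequentially" for q
    using that x limitin_Hausdorff_unique[OF _ p _ Hausdorff_K] by simp
  ultimately have "boundary_map P = p" unfolding boundary_map_def by (intro the_equality) blast+
  then show ?thesis using p by simp
qed

lemma boundary_map_eqI: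
  assumes "P \<in> gromov_boundary_points a" "x \<in> P" "limitin K (\<lambda>n. e (x n)) p sequentially"
  shows "boundary_map P = p"
  using limitin_Hausdorff_unique[OF limitin_boundary_map[OF assms(1,2)] assms(3) _ Hausdorff_K] by simp

lemma boundary_map_in_corona:
  assumes "P \<in> gromov_boundary_points a"
  shows "boundary_map P \<in> topspace (corona K e)"
proof -
  obtain x where x: "x \<in> P" using boundary_points_nonempty[OF assms] by blast
  then show ?thesis
    using limit_in_corona[OF _ limitin_boundary_map[OF assms x]] boundary_points_subset[OF assms]
      limitin_topspace[OF limitin_boundary_map[OF assms x]]
    unfolding corona_def by auto
qed

text \<open>The function from \<open>separating_function\<close>, extended to \<open>K\<close> and
  evaluated at limits. A value below \<open>c\<close> at the image of \<open>Q\<close> forces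
  \<open>Q\<close> into the set of radius \<open>r\<close> around \<open>P\<close>; injectivity and
  openness rest on this.\<close>

lemma boundary_separation:
  assumes P: "P \<in> gromov_boundary_points a" and x: "x \<in> P"
  obtains g c where "unit_map g" "0 < c" "g (boundary_map P) = 0"
    "\<And>Q y. Q \<in> gromov_boundary_points a \<Longrightarrow> y \<in> Q \<Longrightarrow> \<not> ereal r \<le> gromov_liminf a x y \<Longrightarrow>
      c \<le> g (boundary_map Q)"
proof -
  have "x \<in> converging_to_infinity a" using boundary_points_subset[OF P] x by blast
  from separating_function[OF this, of r] obtain f c
    where f: "range f \<subseteq> {0..1::real}" "continuous_on UNIV f" "slowly_oscillating gromov_coarse f"
      and c: "0 < c" and fx: "\<forall>\<^sub>F i in sequentially. f (x i) = 0"
      and fy: "\<And>y. y \<in> converging_to_infinity a \<Longrightarrow> \<not> ereal r \<le> gromov_liminf a x y \<Longrightarrow>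
        \<forall>\<^sub>F j in sequentially. c \<le> f (y j)" by metis
  obtain g where g: "unit_map g" "\<And>x. g (e x) = f x" using extend[OF f] by metis
  have lim: "(\<lambda>n. f (y n)) \<longlonglongrightarrow> g (boundary_map Q)"
    if "Q \<in> gromov_boundary_points a" "y \<in> Q" for Q y
    using unit_map_limit[OF g(1) limitin_boundary_map[OF that]] by (simp add: g(2))
  have "(\<lambda>n. f (x n)) \<longlonglongrightarrow> 0" using fx by (rule tendsto_eventually)
  then have "g (boundary_map P) = 0" using lim[OF P x] LIMSEQ_unique by blast
  moreover have "c \<le> g (boundary_map Q)"
    if Q: "Q \<in> gromov_boundary_points a" "y \<in> Q" and xy: "\<not> ereal r \<le> gromov_liminf a x y" for Q y
  proof (rule tendsto_lowerbound[OF lim[OF Q]])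
    show "\<forall>\<^sub>F n in sequentially. c \<le> f (y n)"
      using fy[OF _ xy] boundary_points_subset[OF Q(1)] Q(2) by blast
  qed simp
  ultimately show thesis using that g(1) c by blast
qed

lemma inj_on_boundary_map: "inj_on boundary_map (gromov_boundary_points a)"
proof (rule inj_onI)
  fix P Q
  assume P: "P \<in> gromov_boundary_points a" and Q: "Q \<in> gromov_boundary_points a"
    and eq: "boundary_map P = boundary_map Q"
  obtain x y where xy: "x \<in> P" "y \<in> Q"
    using boundary_points_nonempty[OF P] boundary_points_nonempty[OF Q] by blast
  have "ereal r \<le> gromov_liminf a x y" for r
  proof (rule ccontr)
    assume r: "\<not> ?thesis"
    show False by (rule boundary_separation[OF P xy(1), of r]) (use Q xy(2) r eq in fastforce)
  qed
  then have "gromov_liminf a x y = \<infinity>" using ereal_top by (metis top_ereal_def)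
  then show "P = Q" using boundary_points_eqI P Q xy by blast
qed

text \<open>Nested sets \<open>W n\<close> with growing mutual products are chosen so that
  \<open>p\<close> stays in the closure of their images; points picked from them converge to
  infinity.\<close>

lemma boundary_map_surj:
  assumes p: "p \<in> topspace K" "p \<notin> range e"
  obtains P where "P \<in> gromov_boundary_points a" "boundary_map P = p"
proof -
  \<comment> \<open>Balls are compact, so their images are closed in \<open>K\<close> and miss
    \<open>p\<close>; bounded parts can be discarded.\<close>
  have closed_ball: "p \<notin> K closure_of (e ` B)" if "B \<subseteq> cball a R" for B R
  proof -
    have "compactin euclidean (cball a R)" using proper by (simp add: proper_metric_def)
    then have "compactin K (e ` cball a R)"
      using image_compactin[OF _ continuous_e] by blast
    then have "closedin K (e ` cball a R)" by (rule compactin_imp_closedin[OF Hausdorff_K])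
    then have "K closure_of (e ` B) \<subseteq> e ` cball a R" using that by (intro closure_of_minimal) auto
    then show ?thesis using p(2) by blast
  qed
  \<comment> \<open>The offset makes stage 0 trivial for \<open>UNIV\<close>, while stage
    \<open>Suc n\<close> asks for products at least \<open>n\<close>.\<close>
  let ?Q = "\<lambda>n W. p \<in> K closure_of (e ` W) \<and> (\<forall>u\<in>W. \<forall>v\<in>W. real n - 1 \<le> gromov_product a u v)"
  have "\<exists>W. \<forall>n. ?Q n (W n) \<and> W (Suc n) \<subseteq> W n"
  proof (rule dependent_nat_choice[where P = ?Q and Q = "\<lambda>_ W W'. W' \<subseteq> W"])
    have "real 0 - 1 \<le> gromov_product a u v" for u v using gromov_product_nonneg[of a u v] by simp
    then show "\<exists>W. ?Q 0 W" using p(1) dense_e by (intro exI[of _ UNIV]) auto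
  next
    fix W n
    assume W: "?Q n W"
    obtain \<V> where \<V>: "finite \<V>" "- cball a (\<bar>real n\<bar> + 1) \<subseteq> \<Union>\<V>"
      "\<And>V u v. V \<in> \<V> \<Longrightarrow> u \<in> V \<Longrightarrow> v \<in> V \<Longrightarrow> real n \<le> gromov_product a u v"
      using finite_gromov_cover[OF proper geodesic] by metis
    \<comment> \<open>Closure commutes with finite unions, so some piece \<open>W \<inter> V\<close>
      keeps \<open>p\<close> in the closure of its image.\<close>
    have "e ` W \<subseteq> e ` (W \<inter> cball a (\<bar>real n\<bar> + 1)) \<union> \<Union> ((\<lambda>V. e ` (W \<inter> V)) ` \<V>)"
      using \<V>(2) by auto
    then have "K closure_of (e ` W) \<subseteq>
        K closure_of (e ` (W \<inter> cball a (\<bar>real n\<bar> + 1)) \<union> \<Union> ((\<lambda>V. e ` (W \<inter> V)) ` \<V>))"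
      by (rule closure_of_mono)
    also have "\<dots> = K closure_of (e ` (W \<inter> cball a (\<bar>real n\<bar> + 1))) \<union>
        (\<Union>V\<in>\<V>. K closure_of (e ` (W \<inter> V)))"
      using \<V>(1) by (simp add: closure_of_Union)
    finally obtain V where V: "V \<in> \<V>" "p \<in> K closure_of (e ` (W \<inter> V))"
      using W closed_ball[of "W \<inter> cball a (\<bar>real n\<bar> + 1)" "\<bar>real n\<bar> + 1"] by blast
    then show "\<exists>W'. ?Q (Suc n) W' \<and> W' \<subseteq> W"
      using \<V>(3) by (intro exI[of _ "W \<inter> V"]) auto
  qed
  then obtain W where W: "\<And>n. ?Q n (W n)" "\<And>n. W (Suc n) \<subseteq> W n" by blast
  have "\<forall>n. \<exists>u. u \<in> W n" using W(1) by (metis closure_of_empty empty_iff equals0I image_empty)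
  then obtain x where x: "\<And>n. x n \<in> W n" by metis
  have anti: "W i \<subseteq> W n" if "n \<le> i" for n i by (rule lift_Suc_antimono_le[of W, OF W(2) that])
  have "x \<in> converging_to_infinity a"
    unfolding converging_to_infinity_iff
  proof
    fix C
    obtain n where n: "C + 1 \<le> real n" using real_arch_simple by blast
    have "C \<le> gromov_product a (x i) (x j)" if "n \<le> i" "n \<le> j" for i j
    proof -
      have "x i \<in> W n" "x j \<in> W n" using anti[OF that(1)] anti[OF that(2)] x by blast+
      then have "real n - 1 \<le> gromov_product a (x i) (x j)" using W(1)[of n] by blast
      then show ?thesis using n by simp
    qed
    then show "\<exists>N. \<forall>i\<ge>N. \<forall>j\<ge>N. C \<le> gromov_product a (x i) (x j)" by blast
  qed
  then obtain P q where P: "P \<in> gromov_boundary_points a" "x \<in> P"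
    and q: "limitin K (\<lambda>n. e (x n)) q sequentially"
    using boundary_point_exists limit_exists by metis
  \<comment> \<open>Some \<open>w\<close> in \<open>W n\<close> has image near \<open>p\<close>, and
    all later \<open>x i\<close> have large product with it, so a function separating
    \<open>p\<close> from \<open>q\<close> cannot approach its value at \<open>q\<close> along the
    sequence.\<close>
  have "p = q"
  proof (rule ccontr)
    assume "p \<noteq> q"
    have qK: "q \<in> topspace K" using limitin_topspace[OF q] .
    have "openin K (topspace K - {q})"
      using Hausdorff_K by (simp add: closedin_Hausdorff_singleton qK openin_diff)
    then obtain g where g: "unit_map g" "g p = 0" "g q = 1"
      using Urysohn_point[of "topspace K - {q}" p] p(1) qK \<open>p \<noteq> q\<close>
      by (metis DiffD2 DiffI singletonD singletonI)
    obtain C where C: "\<And>u v. C \<le> gromov_product a u v \<Longrightarrow> \<bar>g (e u) - g (e v)\<bar> < 1 / 4"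
      using unit_map_uniform[OF g(1), of "1/4"] by auto
    obtain n where n: "C + 1 \<le> real n" using real_arch_simple by blast
    have V: "openin K {z \<in> topspace K. g z \<in> {..<1/4}}"
      using g(1) by (intro openin_continuous_map_preimage[where Y = euclideanreal])
        (auto simp: continuous_map_in_subtopology)
    have "p \<in> {z \<in> topspace K. g z \<in> {..<1/4}}" using g(2) p(1) by simp
    moreover have "p \<in> K closure_of (e ` W n)" using W(1)[of n] by (rule conjunct1)
    ultimately have "\<exists>z. z \<in> e ` W n \<and> z \<in> {z \<in> topspace K. g z \<in> {..<1/4}}"
      using V unfolding in_closure_of by metis
    then obtain w where w: "w \<in> W n" "g (e w) < 1 / 4" by auto
    have "g (e (x i)) \<le> 1 / 2" if "n \<le> i" for i
    proof -
      have "C \<le> gromov_product a (x i) w"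
      proof -
        have "x i \<in> W n" using anti[OF that] x by blast
        then have "real n - 1 \<le> gromov_product a (x i) w" using W(1)[of n] w(1) by blast
        then show ?thesis using n by simp
      qed
      then show ?thesis using C[of "x i" w] w(2) by linarith
    qed
    then have "g q \<le> 1 / 2" using LIMSEQ_le_const2[OF unit_map_limit[OF g(1) q]] by blast
    then show False using g(3) by simp
  qed
  then show thesis using that P boundary_map_eqI[OF P q] by blast
qed

section \<open>The boundary map as a homeomorphism\<close>

lemma image_boundary_map: "boundary_map ` gromov_boundary_points a = topspace (corona K e)"
proof
  show "topspace (corona K e) \<subseteq> boundary_map ` gromov_boundary_points a"
    
  proof
    fix p assume "p \<in> topspace (corona K e)"
    then show "p \<in> boundary_map ` gromov_boundary_points a"
      using boundary_map_surj[of p] unfolding corona_def by auto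
  qed
qed (use boundary_map_in_corona in blast)

lemma continuous_boundary_map: "continuous_map (gromov_boundary a) (corona K e) boundary_map"
  unfolding continuous_map_def
proof (intro conjI allI impI)
  show "boundary_map \<in> topspace (gromov_boundary a) \<rightarrow> topspace (corona K e)"
    using boundary_map_in_corona by simp
  fix U
  assume "openin (corona K e) U"
  then obtain V where V: "openin K V" "U = V \<inter> (topspace K - range e)"
    unfolding corona_def openin_subtopology by blast
  show "openin (gromov_boundary a) {P \<in> topspace (gromov_boundary a). boundary_map P \<in> U}"
    unfolding openin_gromov_boundary topspace_gromov_boundary
  proof (intro conjI ballI)
    fix P
    assume "P \<in> {P \<in> gromov_boundary_points a. boundary_map P \<in> U}"
    then have P: "P \<in> gromov_boundary_points a" "boundary_map P \<in> V" using V(2) by auto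
    obtain g where g: "unit_map g" "g (boundary_map P) = 0"
      "\<And>q. q \<in> topspace K \<Longrightarrow> q \<notin> V \<Longrightarrow> g q = 1"
      using Urysohn_point[OF V(1) P(2)] by blast
    obtain C where C: "\<And>u v. C \<le> gromov_product a u v \<Longrightarrow> \<bar>g (e u) - g (e v)\<bar> < 1 / 2"
      using unit_map_uniform[OF g(1), of "1/2"] by auto
    \<comment> \<open>The absolute value keeps the radius nonnegative; the added 1 makes it exceed
      \<open>C\<close>, since a liminf bound controls only strictly smaller thresholds. The values
      of \<open>g\<close> at the two images then differ by at most 1/2, which excludes the value 1
      taken off \<open>V\<close>.\<close>
    have "boundary_map Q \<in> U" if Q: "Q \<in> boundary_nhd a P (\<bar>C\<bar> + 1)" for Q
    proof -
      obtain x y where xy: "Q \<in> gromov_boundary_points a" "x \<in> P" "y \<in> Q"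
        "ereal (\<bar>C\<bar> + 1) \<le> gromov_liminf a x y"
        using Q unfolding boundary_nhd_def by blast
      obtain N where N: "\<And>i j. N \<le> i \<Longrightarrow> N \<le> j \<Longrightarrow> C < gromov_product a (x i) (y j)"
        using gromov_liminf_ge_imp[OF xy(4), of C] by force
      have "(\<lambda>n. \<bar>g (e (x n)) - g (e (y n))\<bar>) \<longlonglongrightarrow> \<bar>g (boundary_map P) - g (boundary_map Q)\<bar>"
        by (intro tendsto_intros unit_map_limit[OF g(1)] limitin_boundary_map P xy)
      moreover have "\<forall>n\<ge>N. \<bar>g (e (x n)) - g (e (y n))\<bar> \<le> 1 / 2"
        using C N by (meson less_imp_le)
      ultimately have "\<bar>g (boundary_map P) - g (boundary_map Q)\<bar> \<le> 1 / 2"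
        using LIMSEQ_le_const2 by blast
      moreover have "boundary_map Q \<in> topspace K - range e"
        using boundary_map_in_corona[OF xy(1)] unfolding corona_def by simp
      ultimately show ?thesis using g(2,3) V(2) by fastforce
    qed
    moreover have "boundary_nhd a P (\<bar>C\<bar> + 1) \<subseteq> gromov_boundary_points a"
      unfolding boundary_nhd_def by blast
    ultimately show "\<exists>r\<ge>0. boundary_nhd a P r \<subseteq> {P \<in> gromov_boundary_points a. boundary_map P \<in> U}"
      by (intro exI[of _ "\<bar>C\<bar> + 1"]) auto
  qed auto
qed

text \<open>By surjectivity every corona point with \<open>g\<close> below \<open>c\<close> comes
  from some \<open>Q\<close>, which \<open>boundary_separation\<close> places in the neighbourhood
  of \<open>P\<close> inside \<open>V\<close>.\<close>

lemma open_boundary_map: "open_map (gromov_boundary a) (corona K e) boundary_map"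
  unfolding open_map_def
proof (intro allI impI)
  fix V
  assume V: "openin (gromov_boundary a) V"
  then have sub: "V \<subseteq> gromov_boundary_points a" by (simp add: openin_gromov_boundary)
  have "\<exists>T. openin (corona K e) T \<and> boundary_map P \<in> T \<and> T \<subseteq> boundary_map ` V" if "P \<in> V" for P
  proof -
    have P: "P \<in> gromov_boundary_points a" using that sub by blast
    obtain r where r: "boundary_nhd a P r \<subseteq> V" using V \<open>P \<in> V\<close> unfolding openin_gromov_boundary by blast
    obtain x where x: "x \<in> P" using boundary_points_nonempty[OF P] by blast
    obtain g c where g: "unit_map g" "0 < c" "g (boundary_map P) = 0"
      and sep: "\<And>Q y. Q \<in> gromov_boundary_points a \<Longrightarrow> y \<in> Q \<Longrightarrow>
        \<not> ereal r \<le> gromov_liminf a x y \<Longrightarrow> c \<le> g (boundary_map Q)"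
      using boundary_separation[OF P x, of r] by metis
    let ?T = "{q \<in> topspace K. g q \<in> {..<c}} \<inter> (topspace K - range e)"
    have "openin K {q \<in> topspace K. g q \<in> {..<c}}"
      using g(1) by (intro openin_continuous_map_preimage[where Y = euclideanreal])
        (auto simp: continuous_map_in_subtopology)
    then have "openin (corona K e) ?T"
      unfolding corona_def by (rule openin_subtopology_Int)
    moreover have "boundary_map P \<in> ?T"
      using boundary_map_in_corona[OF P] g(2,3) unfolding corona_def by auto
    moreover have "?T \<subseteq> boundary_map ` V"
    proof
      fix q assume q: "q \<in> ?T"
      then obtain Q where Q: "Q \<in> gromov_boundary_points a" "boundary_map Q = q"
        using boundary_map_surj[of q] by blast
      obtain y where y: "y \<in> Q" using boundary_points_nonempty[OF Q(1)] by blast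
      have "ereal r \<le> gromov_liminf a x y" using sep[OF Q(1) y] q Q(2) by fastforce
      then have "Q \<in> boundary_nhd a P r" unfolding boundary_nhd_def using Q(1) x y by blast
      then show "q \<in> boundary_map ` V" using r Q(2) by blast
    qed
    ultimately show ?thesis by blast
  qed
  then show "openin (corona K e) (boundary_map ` V)" by (subst openin_subopen) blast
qed

lemma corona_homeomorphic_gromov_boundary: "corona K e homeomorphic_space gromov_boundary a"
proof -
  have "homeomorphic_map (gromov_boundary a) (corona K e) boundary_map"
    by (rule bijective_open_imp_homeomorphic_map[OF continuous_boundary_map open_boundary_map])
       (simp_all add: image_boundary_map inj_on_boundary_map)
  then show ?thesis
    by (metis homeomorphic_map_imp_homeomorphic_space homeomorphic_space_sym)
qed

end

theorem theorem5p8: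
  fixes a :: "'a::metric_space"
  assumes "proper_metric TYPE('a)"
    and "geodesic_metric TYPE('a)"
    and "gromov_hyperbolic TYPE('a)"
  shows "(\<exists>(K :: (('a \<Rightarrow> real) \<Rightarrow> real) topology) (e :: 'a \<Rightarrow> ('a \<Rightarrow> real) \<Rightarrow> real).
            higson_compactification gromov_coarse K e) \<and>
         (\<forall>(K :: 'k topology) (e :: 'a \<Rightarrow> 'k).
            higson_compactification gromov_coarse K e \<longrightarrow>
            corona K e homeomorphic_space gromov_boundary a)"
proof (intro conjI allI impI)
  have "locally_compact_space (euclidean :: 'a topology)"
    unfolding locally_compact_space_def
  proof (intro ballI)
    fix x :: 'a
    have "compact (cball x 1)" using assms(1) by (simp add: proper_metric_def)
    then show "\<exists>U K. openin euclidean U \<and> compactin euclidean K \<and> x \<in> U \<and> U \<subseteq> K"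
      by (intro exI[of _ "ball x 1"] exI[of _ "cball x 1"]) simp
  qed
  then show "\<exists>(K :: (('a \<Rightarrow> real) \<Rightarrow> real) topology) (e :: 'a \<Rightarrow> ('a \<Rightarrow> real) \<Rightarrow> real).
      higson_compactification gromov_coarse K e"
  proof (rule higson_compactification_exists[OF simple_coarse_structure_gromov_coarse[OF assms(3)] _
        bounded_sets_gromov_coarse[OF assms(1)]])
    fix x :: 'a and U
    assume "open U" "x \<in> U"
    then obtain r where r: "0 < r" "ball x r \<subseteq> U" using openE by blast
    have "bump x r y = 0" if "y \<notin> U" for y
    proof -
      have "r \<le> dist y x" using r(2) that by (metis dist_commute mem_ball not_le subsetD)
      then show ?thesis using r(1) by (simp add: bump_def)
    qed
    then show "\<exists>f. range f \<subseteq> {0..1} \<and> continuous_on UNIV f \<and> slowly_oscillating gromov_coarse f \<and>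
        0 < f x \<and> (\<forall>y. y \<notin> U \<longrightarrow> f y = (0::real))"
      using bump_admissible[OF r(1), of x] by (intro exI[of _ "bump x r"]) (auto simp: bump_def)
  qed
next
  fix K :: "'k topology" and e :: "'a \<Rightarrow> 'k"
  assume K: "higson_compactification gromov_coarse K e"
  obtain \<delta> where "0 < \<delta>" "\<And>x y z a :: 'a.
      min (gromov_product a x z) (gromov_product a z y) - \<delta> / 4 \<le> gromov_product a x y"
    using assms(3) unfolding gromov_hyperbolic_def by blast
  then interpret gromov_higson "\<delta> / 4" a K e
    using K assms(1,2) by unfold_locales simp_all
  show "corona K e homeomorphic_space gromov_boundary a"
    by (rule corona_homeomorphic_gromov_boundary)
qed

end
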